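(* Let $(V,\omega)$ be a real symplectic vector space with $\dim V=2n$, and let $\Lambda$ be its Lagrangian Grassmannian. For every continuous curve $\ell:[a,b]\to\Lambda$ and every pair of Lagrangians $L_0,L_1\in\Lambda$, $$\big|\mu_{L_0}(\ell)-\mu_{L_1}(\ell)\big|\le n-\dim\big(\ell(a)\cap \ell(b)\big).$$
   Context: $\Lambda$ is the set of all Lagrangian ($n$-dimensional isotropic) subspaces of $(V,\omega)$, a compact manifold of dimension $\frac12 n(n+1)$. For $L_1\in\Lambda$, $\Lambda^0(L_1)$ denotes the open set of Lagrangians transverse to $L_1$. If $L_0,L_1\in\Lambda$ are transverse, so that $V=L_0\oplus L_1$, the chart $\varphi_{L_0,L_1}$ from $\Lambda^0(L_1)$ to the space $\mathrm{B}_{\mathrm{sym}}(L_0)$ of symmetric bilinear forms on $L_0$ is defined by $\varphi_{L_0,L_1}(L)=\omega(T\cdot,\cdot)|_{L_0\times L_0}$, where $T:L_0\to L_1$ is the unique linear map whose graph in $L_0\oplus L_1=V$ is $L$. For a symmetric bilinear form $B$, the index $n_-(B)$ is the dimension of a maximal subspace on which $B$ is negative definite, and the coindex is $n_+(B)=n_-(-B)$. For $L_0\in\Lambda$ and a continuous path $\ell:[a,b]\to\Lambda$, the $L_0$-Maslov index $\mu_{L_0}(\ell)\in\mathbb Z$ is the integer characterized by: (a) $\mu_{L_0}$ is invariant under fixed-endpoint homotopies; (b) $\mu_{L_0}$ is additive under concatenation; (c) if $\ell([a,b])\subset\Lambda^0(L_1)$ for some Lagrangian $L_1$ transverse to $L_0$,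 then $\mu_{L_0}(\ell)=n_+[\varphi_{L_0,L_1}(\ell(b))]-n_+[\varphi_{L_0,L_1}(\ell(a))]$. *)

theory Defs
  imports "HOL-Analysis.Analysis"
begin

(* The carrier V of the symplectic space is a type of class euclidean_space, used only as a
   finite-dimensional real vector space: the inner product plays no role below. *)

definition symplectic_form :: "('a::euclidean_space \<Rightarrow> 'a \<Rightarrow> real) \<Rightarrow> bool" where
  "symplectic_form \<omega> \<longleftrightarrow>
     bilinear \<omega> \<and> (\<forall>x. \<omega> x x = 0) \<and> (\<forall>x. (\<forall>y. \<omega> x y = 0) \<longrightarrow> x = 0)"

definition lagrangians :: "('a::euclidean_space \<Rightarrow> 'a \<Rightarrow> real) \<Rightarrow> 'a set set" where
  "lagrangians \<omega> =
     {L. subspace L \<and> (\<forall>x\<in>L. \<forall>y\<in>L. \<omega> x y = 0) \<and> 2 * dim L = DIM('a)}"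

(* Between Lagrangians, trivial intersection is the same as V being their direct sum,
   since the dimensions add up to dim V. *)
definition transverse :: "'a::euclidean_space set \<Rightarrow> 'a set \<Rightarrow> bool" where
  "transverse L L' \<longleftrightarrow> L \<inter> L' = {0}"

definition transverse_lagrangians ::
    "('a::euclidean_space \<Rightarrow> 'a \<Rightarrow> real) \<Rightarrow> 'a set \<Rightarrow> 'a set set" where
  "transverse_lagrangians \<omega> L1 = {L \<in> lagrangians \<omega>. transverse L L1}"

(* The linear map L0 \<rightarrow> L1 whose graph in V = L0 \<oplus> L1 is L, extended by zero on L1
   to a linear endomorphism of V (which makes it unique as a function on V). *)
definition graph_map ::
    "'a::euclidean_space set \<Rightarrow> 'a set \<Rightarrow> 'a set \<Rightarrow> 'a \<Rightarrow> 'a" where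
  "graph_map L0 L1 L =
     (THE T. linear T \<and> T ` L0 \<subseteq> L1 \<and> (\<forall>y\<in>L1. T y = 0) \<and> {x + T x | x. x \<in> L0} = L)"

(* A bilinear form on the subspace L0 is represented by a function on V \<times> V that
   vanishes off L0 \<times> L0. *)
definition chart ::
    "('a::euclidean_space \<Rightarrow> 'a \<Rightarrow> real) \<Rightarrow> 'a set \<Rightarrow> 'a set \<Rightarrow> 'a set \<Rightarrow> ('a \<Rightarrow> 'a \<Rightarrow> real)" where
  "chart \<omega> L0 L1 L =
     (\<lambda>x y. if x \<in> L0 \<and> y \<in> L0 then \<omega> (graph_map L0 L1 L x) y else 0)"

(* The manifold topology of the Lagrangian Grassmannian: the one generated by the chart
   preimages of open sets of forms. On the finite-dimensional space of symmetric bilinear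
   forms on L0 the vector space topology is that of pointwise convergence, i.e. the one
   induced from the product topology of the function type. *)
definition lagrangian_topology ::
    "('a::euclidean_space \<Rightarrow> 'a \<Rightarrow> real) \<Rightarrow> 'a set topology" where
  "lagrangian_topology \<omega> = topology_generated_by
     {{L \<in> transverse_lagrangians \<omega> L1. chart \<omega> L0 L1 L \<in> U} | L0 L1 U.
        L0 \<in> lagrangians \<omega> \<and> L1 \<in> lagrangians \<omega> \<and> transverse L0 L1 \<and> open U}"

definition neg_index :: "'a::euclidean_space set \<Rightarrow> ('a \<Rightarrow> 'a \<Rightarrow> real) \<Rightarrow> nat" where
  "neg_index E B = Max {dim W | W. subspace W \<and> W \<subseteq> E \<and> (\<forall>x\<in>W. x \<noteq> 0 \<longrightarrow> B x x < 0)}"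

definition pos_index :: "'a::euclidean_space set \<Rightarrow> ('a \<Rightarrow> 'a \<Rightarrow> real) \<Rightarrow> nat" where
  "pos_index E B = neg_index E (\<lambda>x y. - B x y)"

(* Only the restriction of l to {a..b} matters. *)
definition lagrangian_path ::
    "('a::euclidean_space \<Rightarrow> 'a \<Rightarrow> real) \<Rightarrow> real \<Rightarrow> real \<Rightarrow> (real \<Rightarrow> 'a set) \<Rightarrow> bool" where
  "lagrangian_path \<omega> a b l \<longleftrightarrow>
     a \<le> b \<and> l ` {a..b} \<subseteq> lagrangians \<omega> \<and>
     continuous_map (top_of_set {a..b}) (lagrangian_topology \<omega>) l"

(* Concatenation is expressed by splitting a path at an intermediate time c. The homotopy
   clause also makes \<mu> a b l independent of the values of l outside {a..b}. *)
definition is_maslov_index ::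
    "('a::euclidean_space \<Rightarrow> 'a \<Rightarrow> real) \<Rightarrow> 'a set \<Rightarrow> (real \<Rightarrow> real \<Rightarrow> (real \<Rightarrow> 'a set) \<Rightarrow> int) \<Rightarrow> bool"
  where
  "is_maslov_index \<omega> L0 \<mu> \<longleftrightarrow>
     (\<forall>a b l l'. lagrangian_path \<omega> a b l \<and> lagrangian_path \<omega> a b l' \<and>
        homotopic_with (\<lambda>h. h a = l a \<and> h b = l b)
          (top_of_set {a..b}) (lagrangian_topology \<omega>) l l' \<longrightarrow>
        \<mu> a b l = \<mu> a b l') \<and>
     (\<forall>a b c l. lagrangian_path \<omega> a b l \<and> c \<in> {a..b} \<longrightarrow>
        \<mu> a b l = \<mu> a c l + \<mu> c b l) \<and>
     (\<forall>a b l L1. lagrangian_path \<omega> a b l \<and> L1 \<in> lagrangians \<omega> \<and> transverse L0 L1 \<and>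
        l ` {a..b} \<subseteq> transverse_lagrangians \<omega> L1 \<longrightarrow>
        \<mu> a b l = int (pos_index L0 (chart \<omega> L0 L1 (l b)))
                 - int (pos_index L0 (chart \<omega> L0 L1 (l a))))"

(* is_maslov_index determines \<mu> on continuous paths only; the values of \<mu> elsewhere are
   irrelevant, so the description operator is applied to the integer, not to \<mu>. *)
definition maslov_index ::
    "('a::euclidean_space \<Rightarrow> 'a \<Rightarrow> real) \<Rightarrow> 'a set \<Rightarrow> real \<Rightarrow> real \<Rightarrow> (real \<Rightarrow> 'a set) \<Rightarrow> int" where
  "maslov_index \<omega> L0 a b l = (THE k. \<exists>\<mu>. is_maslov_index \<omega> L0 \<mu> \<and> \<mu> a b l = k)"

end

theory Submission
  imports Defs
begin

text \<open>
  Let \<open>n\<close> be half the dimension of the symplectic space. For Lagrangians \<open>X\<close> and \<open>Y\<close> transverse to \<open>M\<close>, let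
  \<open>r\<^sub>M(X,Y)\<close> be the coindex of the chart value \<open>\<phi>\<^bsub>X,M\<^esub>(Y)\<close> (\<open>rel_index\<close>). In the affine chart of
  Lagrangians transverse to \<open>M\<close> the form \<open>\<phi>\<^bsub>X,M\<^esub>(Y)\<close> is a difference of two quadratic forms, one
  depending on \<open>Y\<close> and one on \<open>X\<close>. Hence \<open>r\<^sub>M\<close> satisfies the triangle inequality, and
  \<open>r\<^sub>M(A,B) + r\<^sub>M(B,A)\<close> is the rank of that form, at most \<open>n - dim (A \<inter> B)\<close>.

  A change of \<open>M\<close> is governed by \<open>rel_index_cocycle\<close>: \<open>r\<^sub>M(X,Y) - r\<^sub>N(X,Y) = r\<^sub>M(X,N) - r\<^sub>M(Y,N)\<close>.
  It has two consequences. The left side is locally constant in \<open>Y\<close>, because \<open>r\<^sub>M(Y,N)\<close> is the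
  coindex of a nondegenerate form; so the increments of \<open>r\<^sub>M(X,\<cdot>)\<close> along a path patch together,
  and the Maslov index relative to \<open>X\<close> exists, is unique and is homotopy invariant
  (\<open>is_maslov_index_path_index\<close>, \<open>maslov_index_eq_path_index\<close>). Moreover the quantity
  \<open>(r\<^sub>M(X,B) - r\<^sub>M(X,A)) - (r\<^sub>M(X',B) - r\<^sub>M(X',A))\<close>, the Hoermander index, does not depend
  on \<open>M\<close>; so the difference of the Maslov indices relative to \<open>X\<close> and \<open>X'\<close> equals it, with \<open>A\<close> and
  \<open>B\<close> the end points of the path (\<open>path_index_diff\<close>).

  Finally \<open>r\<^sub>M(X,B) \<le> r\<^sub>M(X,A) + r\<^sub>M(A,B)\<close> and \<open>r\<^sub>M(X',A) \<le> r\<^sub>M(X',B) + r\<^sub>M(B,A)\<close>, so this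
  difference is at most \<open>r\<^sub>M(A,B) + r\<^sub>M(B,A) \<le> n - dim (A \<inter> B)\<close>; exchanging \<open>X\<close> and \<open>X'\<close>
  gives the other sign. Lagrangians transverse to all members of a finite family are provided by
  \<open>common_complement\<close>.
\<close>

section \<open>Coindex of symmetric bilinear forms\<close>

lemma finite_dims: "finite {dim W | W::'a::euclidean_space set. P W}"
  by (rule finite_subset[of _ "{..DIM('a)}"]) (auto simp: dim_subset_UNIV)

lemma dim_le_pos_index:
  fixes W :: "'a::euclidean_space set"
  assumes "subspace W" "W \<subseteq> E" "\<And>x. x \<in> W \<Longrightarrow> x \<noteq> 0 \<Longrightarrow> 0 < B x x"
  shows "dim W \<le> pos_index E B"
  unfolding pos_index_def neg_index_def
  by (rule Max_ge[OF finite_dims]) (use assms in auto)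

lemma pos_index_attained:
  fixes E :: "'a::euclidean_space set"
  assumes "0 \<in> E"
  obtains W where "subspace W" "W \<subseteq> E" "\<And>x. x \<in> W \<Longrightarrow> x \<noteq> 0 \<Longrightarrow> 0 < B x x"
    "dim W = pos_index E B"
proof -
  let ?S = "{dim W | W. subspace W \<and> W \<subseteq> E \<and> (\<forall>x\<in>W. x \<noteq> 0 \<longrightarrow> - B x x < 0)}"
  have "dim {0::'a} \<in> ?S" using assms by (intro CollectI exI[of _ "{0}"]) auto
  then have "Max ?S \<in> ?S" by (intro Max_in finite_dims) auto
  then show ?thesis using that unfolding pos_index_def neg_index_def by auto
qed

text \<open>Positive definite subspaces are mapped injectively, since the pulled back form vanishes
  on the kernel.\<close>
lemma pos_index_pullback_le:
  fixes g :: "'a::euclidean_space \<Rightarrow> 'b::euclidean_space"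
  assumes "linear g" "g ` E \<subseteq> E'" "0 \<in> E" "B' 0 0 = 0"
    and eq: "\<And>x. x \<in> E \<Longrightarrow> B' (g x) (g x) = B x x"
  shows "pos_index E B \<le> pos_index E' B'"
proof -
  obtain W where W: "subspace W" "W \<subseteq> E" "\<And>x. x \<in> W \<Longrightarrow> x \<noteq> 0 \<Longrightarrow> 0 < B x x"
    "dim W = pos_index E B" using pos_index_attained[OF \<open>0 \<in> E\<close>, of B] by metis
  have ker: "x = 0" if "x \<in> W" "g x = 0" for x
    using W(2) W(3)[of x] eq[of x] that assms(4) by fastforce
  have "inj_on g (span W)"
    using ker linear_injective_on_subspace_0[OF assms(1) W(1)] W(1) by (simp add: span_eq_iff[THEN iffD2])
  then have "dim (g ` W) = dim W" using assms(1) by (simp add: dim_image_eq)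
  moreover have "dim (g ` W) \<le> pos_index E' B'"
  proof (rule dim_le_pos_index)
    show "subspace (g ` W)" using assms(1) W(1) by (rule linear_subspace_image)
    show "g ` W \<subseteq> E'" using W(2) assms(2) by auto
    fix y assume "y \<in> g ` W" "y \<noteq> 0"
    then obtain x where "x \<in> W" "y = g x" "x \<noteq> 0" using linear_0[OF assms(1)] by auto
    then show "0 < B' y y" using W(2,3) eq by (metis subset_iff)
  qed
  ultimately show ?thesis using W(4) by simp
qed

definition symmetric_form :: "('a::euclidean_space \<Rightarrow> 'a \<Rightarrow> real) \<Rightarrow> bool" where
  "symmetric_form B \<longleftrightarrow> bilinear B \<and> (\<forall>x y. B x y = B y x)"

lemma bilinear_Riesz:
  fixes B :: "'a::euclidean_space \<Rightarrow> 'a \<Rightarrow> real"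
  assumes "bilinear B"
  obtains J where "linear J" "\<And>x y. B x y = J x \<bullet> y"
proof
  let ?J = "\<lambda>x. \<Sum>b\<in>Basis. B x b *\<^sub>R b"
  show "linear ?J"
    by (rule linearI) (simp_all add: bilinear_ladd[OF assms] bilinear_lmul[OF assms]
        scaleR_add_left sum.distrib scaleR_sum_right)
  fix x y
  have "linear (B x)" using assms by (simp add: bilinear_def)
  then have "B x (\<Sum>b\<in>Basis. (y \<bullet> b) *\<^sub>R b) = (\<Sum>b\<in>Basis. (y \<bullet> b) *\<^sub>R B x b)"
    by (simp add: linear_sum linear_cmul)
  then have "B x y = (\<Sum>b\<in>Basis. (y \<bullet> b) * B x b)"
    by (simp only: euclidean_representation real_scaleR_def)
  then show "B x y = ?J x \<bullet> y"
    by (simp add: inner_sum_left inner_commute[of y] mult.commute)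
qed

lemma dim_orthogonal_image:
  fixes J :: "'a::euclidean_space \<Rightarrow> 'a"
  assumes "linear J" "subspace W"
  shows "dim {v. \<forall>w\<in>W. J w \<bullet> v = 0} + dim (J ` W) = DIM('a)"
  using dim_subspace_orthogonal_to_vectors[OF linear_subspace_image[OF assms] subspace_UNIV]
  by (simp add: orthogonal_def)

lemma subspace_annihilator:
  assumes "bilinear (B :: 'a::euclidean_space \<Rightarrow> 'a \<Rightarrow> real)"
  shows "subspace {v. \<forall>w\<in>W. B w v = 0}"
  by (auto simp: subspace_def bilinear_rzero[OF assms] bilinear_radd[OF assms]
      bilinear_rmul[OF assms])

text \<open>No nondegeneracy is assumed: the radical of the form can only enlarge the annihilator.\<close>
lemma dim_annihilator_ge:
  fixes B :: "'a::euclidean_space \<Rightarrow> 'a \<Rightarrow> real"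
  assumes "bilinear B" "subspace W"
  shows "DIM('a) \<le> dim {v. \<forall>w\<in>W. B w v = 0} + dim W"
proof -
  obtain J where J: "linear J" "\<And>x y. B x y = J x \<bullet> y" using bilinear_Riesz[OF assms(1)] by blast
  show ?thesis
    using dim_orthogonal_image[OF J(1) assms(2)] dim_image_le[OF J(1), of W] by (simp add: J(2))
qed

lemma dim_annihilator_nondegenerate:
  fixes B :: "'a::euclidean_space \<Rightarrow> 'a \<Rightarrow> real"
  assumes "bilinear B" "subspace W" "\<And>x. (\<And>y. B x y = 0) \<Longrightarrow> x = 0"
  shows "dim {v. \<forall>w\<in>W. B w v = 0} + dim W = DIM('a)"
proof -
  obtain J where J: "linear J" "\<And>x y. B x y = J x \<bullet> y" using bilinear_Riesz[OF assms(1)] by blast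
  have "inj J" using assms(3) by (simp add: linear_injective_0[OF J(1)] J(2))
  then have "dim (J ` W) = dim W" using J(1) by (simp add: dim_image_eq inj_on_subset)
  then show ?thesis using dim_orthogonal_image[OF J(1) assms(2)] by (simp add: J(2))
qed

lemma dim_Int_trivial_le:
  fixes S T :: "'a::euclidean_space set"
  assumes "subspace S" "subspace T" "S \<inter> T \<subseteq> {0}"
  shows "dim S + dim T \<le> DIM('a)"
proof -
  have "dim (S \<inter> T) = 0" using assms(3) by (simp only: dim_eq_0)
  then show ?thesis using dim_sums_Int[OF assms(1,2)] dim_subset_UNIV[of "{x + y |x y. x \<in> S \<and> y \<in> T}"]
    by linarith
qed

lemma dim_sums_trivial_Int:
  fixes S T :: "'a::euclidean_space set"
  assumes "subspace S" "subspace T" "S \<inter> T \<subseteq> {0}"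
  shows "dim {x + y |x y. x \<in> S \<and> y \<in> T} = dim S + dim T"
proof -
  have "dim (S \<inter> T) = 0" using assms(3) by (simp only: dim_eq_0)
  then show ?thesis using dim_sums_Int[OF assms(1,2)] by linarith
qed

lemma pos_index_le_of_nonpos:
  fixes W :: "'a::euclidean_space set"
  assumes "subspace W" "\<And>x. x \<in> W \<Longrightarrow> B x x \<le> 0"
  shows "pos_index UNIV B + dim W \<le> DIM('a)"
proof -
  obtain P where P: "subspace P" "\<And>x. x \<in> P \<Longrightarrow> x \<noteq> 0 \<Longrightarrow> 0 < B x x"
    "dim P = pos_index UNIV B" using pos_index_attained[of UNIV B] by auto
  have "P \<inter> W \<subseteq> {0}" using P(2) assms(2) by fastforce
  then show ?thesis using dim_Int_trivial_le[OF P(1) assms(1)] P(3) by simp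
qed

text \<open>Sylvester decomposition: the orthogonal of a positive definite subspace of maximal dimension is
  nonpositive by maximality, and the two subspaces span the space.\<close>
lemma Sylvester_decomposition:
  fixes B :: "'a::euclidean_space \<Rightarrow> 'a \<Rightarrow> real"
  assumes "symmetric_form B"
  obtains P N where "subspace P" "\<And>x. x \<in> P \<Longrightarrow> x \<noteq> 0 \<Longrightarrow> 0 < B x x" "dim P = pos_index UNIV B"
    "subspace N" "\<And>x. x \<in> N \<Longrightarrow> B x x \<le> 0" "dim N + pos_index UNIV B = DIM('a)"
    "\<And>x y. x \<in> P \<Longrightarrow> y \<in> N \<Longrightarrow> B x y = 0" "\<And>v. \<exists>x\<in>P. \<exists>y\<in>N. v = x + y"
proof -
  have bil: "bilinear B" and sym: "\<And>x y. B x y = B y x" using assms by (auto simp: symmetric_form_def)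
  obtain P where P: "subspace P" "\<And>x. x \<in> P \<Longrightarrow> x \<noteq> 0 \<Longrightarrow> 0 < B x x"
    "dim P = pos_index UNIV B" using pos_index_attained[of UNIV B] by auto
  define N where "N = {v. \<forall>w\<in>P. B w v = 0}"
  have N: "subspace N" unfolding N_def by (rule subspace_annihilator[OF bil])
  have orth: "B x y = 0" if "x \<in> P" "y \<in> N" for x y using that by (auto simp: N_def)
  have nonpos: "B v v \<le> 0" if v: "v \<in> N" for v
  proof (rule ccontr)
    assume "\<not> B v v \<le> 0"
    then have pos: "B v v > 0" by simp
    have "v \<notin> P" using orth[of v v] v pos by auto
    have "dim (insert v P) = dim P + 1"
      using \<open>v \<notin> P\<close> P(1) by (simp add: dim_insert span_eq_iff[THEN iffD2])
    moreover have "dim (span (insert v P)) \<le> pos_index UNIV B"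
    proof (rule dim_le_pos_index)
      fix x assume x: "x \<in> span (insert v P)" "x \<noteq> 0"
      then obtain k where "x - k *\<^sub>R v \<in> P" using P(1) by (auto simp: span_insert span_eq_iff[THEN iffD2])
      then obtain p where p: "p \<in> P" "x = p + k *\<^sub>R v" by (metis diff_add_cancel)
      have "B x x = B p p + k\<^sup>2 * B v v"
        using orth[OF p(1) v] sym[of v p] unfolding p(2)
        by (simp add: bilinear_ladd[OF bil] bilinear_radd[OF bil] bilinear_lmul[OF bil]
            bilinear_rmul[OF bil] power2_eq_square)
      moreover have "p \<noteq> 0 \<or> k \<noteq> 0" using x(2) p(2) by auto
      moreover have "B p p \<ge> 0" using P(2)[OF p(1)] bilinear_lzero[OF bil] by (cases "p = 0") auto
      moreover have "k\<^sup>2 * B v v \<ge> 0" using pos by simp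
      ultimately show "0 < B x x" using P(2)[OF p(1)] pos
        by (metis add_nonneg_pos add_pos_nonneg zero_less_mult_iff zero_less_power2)
    qed auto
    ultimately show False using P(3) by (simp add: dim_span)
  qed
  have triv: "P \<inter> N \<subseteq> {0}" using orth P(2) by fastforce
  have dN: "dim N + dim P = DIM('a)"
    using dim_annihilator_ge[OF bil P(1)] dim_Int_trivial_le[OF P(1) N triv] unfolding N_def by simp
  have "dim {x + y |x y. x \<in> P \<and> y \<in> N} = DIM('a)"
    using dim_sums_trivial_Int[OF P(1) N triv] dN by simp
  then have "span {x + y |x y. x \<in> P \<and> y \<in> N} = UNIV" by (simp only: dim_eq_full)
  then have "{x + y |x y. x \<in> P \<and> y \<in> N} = UNIV"
    using subspace_sums[OF P(1) N] by (simp add: span_eq_iff[THEN iffD2])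
  then have "\<exists>x\<in>P. \<exists>y\<in>N. v = x + y" for v by blast
  then show ?thesis using that[OF P N nonpos _ orth] dN P(3) by simp
qed

lemma dim_Int_ge:
  fixes S T :: "'a::euclidean_space set"
  assumes "subspace S" "subspace T"
  shows "dim S + dim T \<le> DIM('a) + dim (S \<inter> T)"
  using dim_sums_Int[OF assms] dim_subset_UNIV[of "{x + y |x y. x \<in> S \<and> y \<in> T}"] by simp

text \<open>On the intersection of nonpositive subspaces of maximal dimension for \<open>B\<close> and \<open>C\<close> the sum is
  nonpositive.\<close>
lemma pos_index_add_le:
  fixes B C :: "'a::euclidean_space \<Rightarrow> 'a \<Rightarrow> real"
  assumes "symmetric_form B" "symmetric_form C"
  shows "pos_index UNIV (\<lambda>x y. B x y + C x y) \<le> pos_index UNIV B + pos_index UNIV C"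
proof -
  obtain N where N: "subspace N" "\<And>x. x \<in> N \<Longrightarrow> B x x \<le> 0" "dim N + pos_index UNIV B = DIM('a)"
    using Sylvester_decomposition[OF assms(1)] by metis
  obtain M where M: "subspace M" "\<And>x. x \<in> M \<Longrightarrow> C x x \<le> 0" "dim M + pos_index UNIV C = DIM('a)"
    using Sylvester_decomposition[OF assms(2)] by metis
  have "pos_index UNIV (\<lambda>x y. B x y + C x y) + dim (N \<inter> M) \<le> DIM('a)"
    by (rule pos_index_le_of_nonpos[OF subspace_inter[OF N(1) M(1)]])
      (use N(2) M(2) in \<open>auto intro: add_nonpos_nonpos\<close>)
  then show ?thesis using dim_Int_ge[OF N(1) M(1)] N(3) M(3) by linarith
qed

lemma pos_index_orthogonal_sum:
  fixes B :: "'a::euclidean_space \<Rightarrow> 'a \<Rightarrow> real" and C :: "'b::euclidean_space \<Rightarrow> 'b \<Rightarrow> real"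
  assumes "symmetric_form B" "symmetric_form C"
  shows "pos_index UNIV (\<lambda>u v. B (fst u) (fst v) + C (snd u) (snd v))
    = pos_index UNIV B + pos_index UNIV C" (is "pos_index UNIV ?D = _")
proof -
  obtain P N where N: "subspace P" "\<And>x. x \<in> P \<Longrightarrow> x \<noteq> 0 \<Longrightarrow> 0 < B x x" "dim P = pos_index UNIV B"
     "subspace N" "\<And>x. x \<in> N \<Longrightarrow> B x x \<le> 0" "dim N + pos_index UNIV B = DIM('a)"
    using Sylvester_decomposition[OF assms(1)] by metis
  obtain Q M where M: "subspace Q" "\<And>x. x \<in> Q \<Longrightarrow> x \<noteq> 0 \<Longrightarrow> 0 < C x x" "dim Q = pos_index UNIV C"
     "subspace M" "\<And>x. x \<in> M \<Longrightarrow> C x x \<le> 0" "dim M + pos_index UNIV C = DIM('b)"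
    using Sylvester_decomposition[OF assms(2)] by metis
  have z: "B 0 0 = 0" "C 0 0 = 0"
    using assms by (auto simp: symmetric_form_def bilinear_lzero)
  have "pos_index UNIV ?D + dim (N \<times> M) \<le> DIM('a \<times> 'b)"
    by (rule pos_index_le_of_nonpos[OF subspace_Times[OF N(4) M(4)]])
      (use N(5) M(5) in \<open>auto intro: add_nonpos_nonpos\<close>)
  then have "pos_index UNIV ?D \<le> pos_index UNIV B + pos_index UNIV C"
    using N(4,6) M(4,6) by (simp add: dim_Times)
  moreover have "dim (P \<times> Q) \<le> pos_index UNIV ?D"
  proof (rule dim_le_pos_index[OF subspace_Times[OF N(1) M(1)]])
    fix x assume "x \<in> P \<times> Q" "x \<noteq> 0"
    then show "0 < ?D x x" using N(2)[of "fst x"] M(2)[of "snd x"] z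
      by (cases "fst x = 0"; cases "snd x = 0") (auto simp: prod_eq_iff add_pos_pos)
  qed simp
  ultimately show ?thesis using N(1,3) M(1,3) by (simp add: dim_Times)
qed

text \<open>Together with the next lemma: the index and the coindex add up to the rank.\<close>
lemma pos_index_add_uminus_le:
  fixes B :: "'a::euclidean_space \<Rightarrow> 'a \<Rightarrow> real"
  assumes "symmetric_form B" "subspace K" "\<And>x y. x \<in> K \<Longrightarrow> B x y = 0"
  shows "pos_index UNIV B + pos_index UNIV (\<lambda>x y. - B x y) + dim K \<le> DIM('a)"
proof -
  have bil: "bilinear B" and sym: "\<And>x y. B x y = B y x" using assms by (auto simp: symmetric_form_def)
  obtain P where P: "subspace P" "\<And>x. x \<in> P \<Longrightarrow> x \<noteq> 0 \<Longrightarrow> 0 < - B x x"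
    "dim P = pos_index UNIV (\<lambda>x y. - B x y)" using pos_index_attained[of UNIV "\<lambda>x y. - B x y"] by auto
  have "P \<inter> K \<subseteq> {0}" using P(2) assms(3) by fastforce
  note d = dim_sums_trivial_Int[OF P(1) assms(2) this]
  have "pos_index UNIV B + dim {x + y |x y. x \<in> P \<and> y \<in> K} \<le> DIM('a)"
  proof (rule pos_index_le_of_nonpos[OF subspace_sums[OF P(1) assms(2)]])
    fix v assume "v \<in> {x + y |x y. x \<in> P \<and> y \<in> K}"
    then obtain x y where v: "v = x + y" "x \<in> P" "y \<in> K" by auto
    have "B v v = B x x" using assms(3)[OF v(3)] sym[of x y] unfolding v(1)
      by (simp add: bilinear_ladd[OF bil] bilinear_radd[OF bil])
    then show "B v v \<le> 0" using P(2)[OF v(2)] bilinear_lzero[OF bil] by (cases "x = 0") auto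
  qed
  then show ?thesis using d P(3) by simp
qed

lemma pos_index_add_uminus_ge:
  fixes B :: "'a::euclidean_space \<Rightarrow> 'a \<Rightarrow> real"
  assumes "symmetric_form B" "subspace K" "\<And>x. (\<And>y. B x y = 0) \<Longrightarrow> x \<in> K"
  shows "DIM('a) \<le> pos_index UNIV B + pos_index UNIV (\<lambda>x y. - B x y) + dim K"
proof -
  have bil: "bilinear B" and sym: "\<And>x y. B x y = B y x" using assms by (auto simp: symmetric_form_def)
  obtain P N where N: "subspace N" "\<And>x. x \<in> N \<Longrightarrow> B x x \<le> 0" "dim N + pos_index UNIV B = DIM('a)"
    "\<And>x y. x \<in> P \<Longrightarrow> y \<in> N \<Longrightarrow> B x y = 0" "\<And>v. \<exists>x\<in>P. \<exists>y\<in>N. v = x + y"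
    by (rule Sylvester_decomposition[OF assms(1)]) (rule that; assumption)
  define C where "C = {v. \<forall>k\<in>K. k \<bullet> v = 0}"
  have sC: "subspace C" unfolding C_def
    by (rule subspace_annihilator) (simp add: bilinear_def bounded_linear.linear
        bounded_linear_inner_left bounded_linear_inner_right)
  have dC: "dim C + dim K = DIM('a)"
    using dim_orthogonal_image[OF linear_id assms(2)] by (simp add: C_def)
  have "dim (N \<inter> C) \<le> pos_index UNIV (\<lambda>x y. - B x y)"
  proof (rule dim_le_pos_index[OF subspace_inter[OF N(1) sC]])
    fix v assume v: "v \<in> N \<inter> C" "v \<noteq> 0"
    have "B v v \<noteq> 0"
    proof
      assume 0: "B v v = 0"
      \<comment> \<open>Cauchy--Schwarz on the semidefinite subspace \<open>N\<close>: an isotropic vector is in the radical.\<close>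
      have NN: "B v w = 0" if w: "w \<in> N" for w
      proof (rule ccontr)
        assume c: "B v w \<noteq> 0"
        \<comment> \<open>With this \<open>t\<close> the form takes the value \<open>1\<close> at \<open>w + t v\<close>.\<close>
        define t where "t = (1 - B w w) / (2 * B v w)"
        have "w + t *\<^sub>R v \<in> N" using w v(1) N(1) by (simp add: subspace_add subspace_mul)
        then have "B (w + t *\<^sub>R v) (w + t *\<^sub>R v) \<le> 0" by (rule N(2))
        moreover have "B (w + t *\<^sub>R v) (w + t *\<^sub>R v) = B w w + 2 * t * B v w"
          using 0 sym[of w v] by (simp add: bilinear_ladd[OF bil] bilinear_radd[OF bil]
              bilinear_lmul[OF bil] bilinear_rmul[OF bil])
        moreover have "2 * t * B v w = 1 - B w w" using c by (simp add: t_def)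
        ultimately show False by simp
      qed
      have "B v y = 0" for y
      proof -
        obtain p q where "p \<in> P" "q \<in> N" "y = p + q" using N(5) by blast
        then show ?thesis using N(4)[of p v] NN[of q] v(1) sym[of v p]
          by (simp add: bilinear_radd[OF bil])
      qed
      then have "v \<in> K" by (rule assms(3))
      then have "v \<bullet> v = 0" using v(1) by (auto simp: C_def)
      then show False using v(2) by simp
    qed
    then show "0 < - B v v" using N(2)[of v] v(1) by simp
  qed simp
  then show ?thesis using dim_Int_ge[OF N(1) sC] dC N(3) by linarith
qed

text \<open>Positive definiteness on a subspace \<open>W\<close> is an open condition for the topology of pointwise
  convergence, since it suffices to control the finitely many values at pairs from an orthonormal
  basis of \<open>W\<close>. The neighbourhood \<open>U\<close> consists of arbitrary functions; it is used for those members
  that agree on \<open>W\<close> with a bilinear form \<open>C\<close>.\<close>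
lemma positive_definite_stable:
  fixes B :: "'a::euclidean_space \<Rightarrow> 'a \<Rightarrow> real" and q :: "'a \<Rightarrow> 'a \<Rightarrow> real"
  assumes "bilinear B" "subspace W" "\<And>x. x \<in> W \<Longrightarrow> x \<noteq> 0 \<Longrightarrow> 0 < B x x"
    and q: "\<And>x y. x \<in> W \<Longrightarrow> y \<in> W \<Longrightarrow> q x y = B x y"
  obtains U where "open U" "q \<in> U"
    "\<And>C x. bilinear C \<Longrightarrow> (\<exists>q'\<in>U. \<forall>x\<in>W. \<forall>y\<in>W. q' x y = C x y) \<Longrightarrow> x \<in> W \<Longrightarrow> x \<noteq> 0 \<Longrightarrow> 0 < C x x"
proof -
  obtain bs where bs: "bs \<subseteq> W" "pairwise orthogonal bs" "\<And>x. x \<in> bs \<Longrightarrow> norm x = 1"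
    "independent bs" "card bs = dim W" "span bs = W"
    using orthonormal_basis_subspace[OF assms(2)] by blast
  have fin: "finite bs" using bs(4) by (rule independent_imp_finite)
  obtain m where m: "m > 0" "\<And>x. x \<in> W \<Longrightarrow> m * (norm x)\<^sup>2 \<le> B x x"
  proof (cases "W = {0}")
    case True then show ?thesis using that[of 1] bilinear_lzero[OF assms(1)] by auto
  next
    case False
    let ?S = "W \<inter> sphere 0 1"
    have "compact ?S" using closed_subspace[OF assms(2)] by (simp add: closed_Int_compact)
    moreover have "?S \<noteq> {}"
    proof -
      obtain x where "x \<in> W" "x \<noteq> 0" using False assms(2) subspace_0 by blast
      then have "x /\<^sub>R norm x \<in> ?S" using assms(2) by (simp add: subspace_mul)
      then show ?thesis by blast
    qed
    moreover have "continuous_on ?S (\<lambda>x. B x x)"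
      by (rule bilinear_continuous_on_compose[OF continuous_on_id continuous_on_id assms(1)])
    ultimately obtain z where z: "z \<in> ?S" "\<And>x. x \<in> ?S \<Longrightarrow> B z z \<le> B x x"
      using continuous_attains_inf[of ?S "\<lambda>x. B x x"] by blast
    have "B z z > 0" using z(1) assms(3)[of z] by force
    moreover have "B z z * (norm x)\<^sup>2 \<le> B x x" if x: "x \<in> W" for x
    proof (cases "x = 0")
      case True then show ?thesis using bilinear_lzero[OF assms(1)] by simp
    next
      case False
      have "B z z \<le> B (x /\<^sub>R norm x) (x /\<^sub>R norm x)"
        using x False assms(2) by (intro z(2)) (simp add: subspace_mul)
      also have "\<dots> = B x x / (norm x)\<^sup>2"
        by (simp add: bilinear_lmul[OF assms(1)] bilinear_rmul[OF assms(1)] power2_eq_square field_simps)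
      finally show ?thesis using False by (simp add: field_simps)
    qed
    ultimately show ?thesis using that by blast
  qed
  \<comment> \<open>Any \<open>e\<close> with \<open>(card bs)\<^sup>2 * e < m\<close> works: a perturbation of each entry by at most \<open>e\<close> changes
     the form at \<open>x\<close> by at most \<open>(card bs)\<^sup>2 * e * (norm x)\<^sup>2\<close>.\<close>
  define e where "e = m / (2 * (1 + (real (card bs))\<^sup>2))"
  have e: "e > 0" using m(1) by (auto simp: e_def intro!: divide_pos_pos add_pos_nonneg)
  define U where "U = (\<Inter>b\<in>bs. \<Inter>c\<in>bs. {q'::'a\<Rightarrow>'a\<Rightarrow>real. dist (q' b c) (q b c) < e})"
  have "open U" unfolding U_def
  proof (intro open_INT ballI fin)
    fix b c
    have "continuous_on UNIV (\<lambda>q'::'a\<Rightarrow>'a\<Rightarrow>real. q' b c)"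
      using continuous_on_product_then_coordinatewise[OF continuous_on_product_coordinates] .
    then show "open {q'::'a\<Rightarrow>'a\<Rightarrow>real. dist (q' b c) (q b c) < e}"
      by (intro open_Collect_less continuous_intros)
  qed
  moreover have "q \<in> U" using e by (simp add: U_def)
  moreover have "0 < C x x" if C: "bilinear C" and q': "q' \<in> U" "\<forall>x\<in>W. \<forall>y\<in>W. q' x y = C x y"
    and x: "x \<in> W" "x \<noteq> 0" for C q' x
  proof -
    have xs: "x = (\<Sum>b\<in>bs. (x \<bullet> b) *\<^sub>R b)"
    proof (rule sym, rule orthonormal_basis_expand[OF bs(2)])
      show "x \<in> span bs" using x bs(6) by simp
    qed (use bs(3) fin in auto)
    have exp: "G x x = (\<Sum>b\<in>bs. \<Sum>c\<in>bs. (x \<bullet> b) * (x \<bullet> c) * G b c)" if "bilinear G" for G :: "'a\<Rightarrow>'a\<Rightarrow>real"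
    proof -
      have "G x x = G (\<Sum>b\<in>bs. (x \<bullet> b) *\<^sub>R b) (\<Sum>c\<in>bs. (x \<bullet> c) *\<^sub>R c)" using xs by simp
      also have "\<dots> = (\<Sum>(b,c)\<in>bs \<times> bs. G ((x \<bullet> b) *\<^sub>R b) ((x \<bullet> c) *\<^sub>R c))"
        by (rule bilinear_sum[OF that])
      also have "\<dots> = (\<Sum>b\<in>bs. \<Sum>c\<in>bs. (x \<bullet> b) * (x \<bullet> c) * G b c)"
        by (simp add: sum.cartesian_product bilinear_lmul[OF that] bilinear_rmul[OF that]
            mult.assoc mult.left_commute)
      finally show ?thesis .
    qed
    have "C x x - B x x = (\<Sum>b\<in>bs. \<Sum>c\<in>bs. (x \<bullet> b) * (x \<bullet> c) * (C b c - B b c))"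
      by (simp add: exp[OF C] exp[OF assms(1)] sum_subtractf right_diff_distrib)
    also have "\<bar>\<dots>\<bar> \<le> (\<Sum>b\<in>bs. \<Sum>c\<in>bs. (norm x)\<^sup>2 * e)"
    proof (intro order_trans[OF sum_abs] sum_mono)
      fix b c assume bc: "b \<in> bs" "c \<in> bs"
      have "b \<in> W" "c \<in> W" using bc bs(1) by auto
      then have "q' b c = C b c" "q b c = B b c" using q'(2) q by auto
      moreover have "dist (q' b c) (q b c) < e" using q'(1) bc by (simp add: U_def)
      ultimately have "\<bar>C b c - B b c\<bar> \<le> e" by (simp add: dist_real_def)
      moreover have "\<bar>x \<bullet> b\<bar> \<le> norm x" "\<bar>x \<bullet> c\<bar> \<le> norm x"
        using Cauchy_Schwarz_ineq2[of x b] Cauchy_Schwarz_ineq2[of x c] bs(3) bc by auto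
      ultimately show "\<bar>(x \<bullet> b) * (x \<bullet> c) * (C b c - B b c)\<bar> \<le> (norm x)\<^sup>2 * e"
        unfolding abs_mult power2_eq_square by (intro mult_mono) auto
    qed
    also have "\<dots> = (norm x)\<^sup>2 * ((real (card bs))\<^sup>2 * e)" by (simp add: power2_eq_square)
    also have "\<dots> < (norm x)\<^sup>2 * m"
    proof (rule mult_strict_left_mono)
      define r where "r = (real (card bs))\<^sup>2"
      have "r \<ge> 0" by (simp add: r_def)
      then have "0 < m * (2 + r)" "0 < 2 * (1 + r)" using m(1) by simp_all
      then have "r * (m / (2 * (1 + r))) < m" by (simp add: divide_simps algebra_simps)
      then show "(real (card bs))\<^sup>2 * e < m" by (simp add: e_def r_def)
    qed (use x in auto)
    also have "\<dots> \<le> B x x" using m(2)[OF x(1)] by (simp add: mult.commute)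
    finally show ?thesis by linarith
  qed
  ultimately show ?thesis using that by blast
qed

section \<open>Lagrangian splittings and relative coindices\<close>

locale symplectic_space =
  fixes \<omega> :: "'a::euclidean_space \<Rightarrow> 'a \<Rightarrow> real"
  assumes symplectic: "symplectic_form \<omega>"
begin

lemma bil: "bilinear \<omega>"
  using symplectic by (simp add: symplectic_form_def)

lemma skew: "\<omega> x y = - \<omega> y x"
proof -
  have "\<omega> (x + y) (x + y) = 0" "\<omega> x x = 0" "\<omega> y y = 0"
    using symplectic by (auto simp: symplectic_form_def)
  then show ?thesis by (simp add: bilinear_ladd[OF bil] bilinear_radd[OF bil])
qed

lemma nondegenerate: "(\<And>y. \<omega> x y = 0) \<Longrightarrow> x = 0"
  using symplectic by (auto simp: symplectic_form_def)

lemma lagrangianD: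
  assumes "L \<in> lagrangians \<omega>"
  shows "subspace L" "2 * dim L = DIM('a)" "x \<in> L \<Longrightarrow> y \<in> L \<Longrightarrow> \<omega> x y = 0"
  using assms by (auto simp: lagrangians_def)

lemma subspace_perp: "subspace {v. \<forall>w\<in>W. \<omega> w v = 0}"
  by (rule subspace_annihilator[OF bil])

lemma dim_perp: "subspace W \<Longrightarrow> dim {v. \<forall>w\<in>W. \<omega> w v = 0} + dim W = DIM('a)"
  by (rule dim_annihilator_nondegenerate[OF bil]) (auto intro: nondegenerate)

text \<open>The nontrivial inclusion: the double symplectic orthogonal of \<open>W\<close> is contained in \<open>W\<close>.\<close>
lemma perp_perp:
  assumes "subspace W" "\<And>v. (\<And>w. w \<in> W \<Longrightarrow> \<omega> w v = 0) \<Longrightarrow> \<omega> v x = 0"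
  shows "x \<in> W"
proof -
  let ?P = "{v. \<forall>w\<in>W. \<omega> w v = 0}" let ?PP = "{v. \<forall>w\<in>?P. \<omega> w v = 0}"
  have "\<omega> v w = 0" if "w \<in> W" "v \<in> ?P" for v w using that skew[of v w] by simp
  then have "W \<subseteq> ?PP" by blast
  moreover have "dim W = dim ?PP"
    using dim_perp[OF assms(1)] dim_perp[OF subspace_perp[of W]] by linarith
  ultimately have "W = ?PP"
    by (intro subspace_dim_equal assms(1) subspace_perp) auto
  then show ?thesis using assms(2) by blast
qed

lemma lagrangian_perp:
  assumes "L \<in> lagrangians \<omega>" "\<And>w. w \<in> L \<Longrightarrow> \<omega> w v = 0"
  shows "v \<in> L"
proof -
  let ?P = "{v. \<forall>w\<in>L. \<omega> w v = 0}"
  have "L \<subseteq> ?P" using lagrangianD(3)[OF assms(1)] by auto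
  moreover have "dim L = dim ?P"
    using dim_perp[OF lagrangianD(1)[OF assms(1)]] lagrangianD(2)[OF assms(1)] by linarith
  ultimately have "L = ?P"
    by (intro subspace_dim_equal lagrangianD(1)[OF assms(1)] subspace_perp) auto
  then show ?thesis using assms(2) by blast
qed

text \<open>Two transverse Lagrangian subspaces; by dimension the ambient space is their direct sum. The
  first argument mostly plays the role of the direction \<open>M\<close> along which one projects.\<close>
definition compl :: "'a set \<Rightarrow> 'a set \<Rightarrow> bool" where
  "compl M X \<longleftrightarrow> M \<in> lagrangians \<omega> \<and> X \<in> lagrangians \<omega> \<and> transverse M X"

lemma compl_sym: "compl M X \<Longrightarrow> compl X M"
  by (auto simp: compl_def transverse_def)

lemma compl_unique_split:
  assumes "compl M X"
  shows "\<exists>!x. x \<in> X \<and> u - x \<in> M"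
proof -
  have M: "M \<in> lagrangians \<omega>" and X: "X \<in> lagrangians \<omega>" and t: "M \<inter> X = {0}"
    using assms by (auto simp: compl_def transverse_def)
  note s = lagrangianD(1)[OF M] lagrangianD(1)[OF X]
  have "dim {x + y |x y. x \<in> M \<and> y \<in> X} = DIM('a)"
    using dim_sums_trivial_Int[OF s] t lagrangianD(2)[OF M] lagrangianD(2)[OF X] by simp
  then have "span {x + y |x y. x \<in> M \<and> y \<in> X} = UNIV" by (simp only: dim_eq_full)
  then have "{x + y |x y. x \<in> M \<and> y \<in> X} = UNIV"
    using subspace_sums[OF s] by (simp add: span_eq_iff[THEN iffD2])
  then obtain m x where "u = m + x" "m \<in> M" "x \<in> X" by blast
  then have x: "x \<in> X" "u - x \<in> M" by auto
  show ?thesis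
  proof (rule ex1I[of _ x])
    show "x \<in> X \<and> u - x \<in> M" using x by simp
    fix y assume "y \<in> X \<and> u - y \<in> M"
    then have y: "y \<in> X" "u - y \<in> M" by auto
    have "y - x \<in> X" using subspace_diff[OF s(2) y(1) x(1)] .
    moreover have "y - x \<in> M" using subspace_diff[OF s(1) x(2) y(2)] by simp
    ultimately have "y - x \<in> M \<inter> X" by (rule IntI[rotated])
    then show "y = x" unfolding t by simp
  qed
qed

text \<open>The projection of the ambient space onto \<open>X\<close> along \<open>M\<close>.\<close>
definition proj :: "'a set \<Rightarrow> 'a set \<Rightarrow> 'a \<Rightarrow> 'a" where
  "proj M X u = (THE x. x \<in> X \<and> u - x \<in> M)"

lemma proj_in: "compl M X \<Longrightarrow> proj M X u \<in> X"
  and proj_diff_in: "compl M X \<Longrightarrow> u - proj M X u \<in> M"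
  using theI'[OF compl_unique_split[of M X u]] by (auto simp: proj_def)

lemma proj_eqI: "compl M X \<Longrightarrow> x \<in> X \<Longrightarrow> u - x \<in> M \<Longrightarrow> proj M X u = x"
  using compl_unique_split[of M X u] proj_in proj_diff_in by blast

lemma compl_subspace:
  assumes "compl M X" shows "subspace M" "subspace X"
  using assms lagrangianD(1) by (auto simp: compl_def)

lemma linear_proj:
  assumes "compl M X" shows "linear (proj M X)"
proof (rule linearI)
  fix u v and c :: real
  note s = compl_subspace[OF assms] and p = proj_in[OF assms] proj_diff_in[OF assms]
  show "proj M X (u + v) = proj M X u + proj M X v"
    using subspace_add[OF s(1) p(2)[of u] p(2)[of v]]
    by (intro proj_eqI[OF assms]) (simp_all add: subspace_add[OF s(2)] p algebra_simps)
  show "proj M X (c *\<^sub>R u) = c *\<^sub>R proj M X u"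
    using subspace_mul[OF s(1) p(2)[of u], of c]
    by (intro proj_eqI[OF assms]) (simp_all add: subspace_mul[OF s(2)] p algebra_simps)
qed

lemma proj_id: "compl M X \<Longrightarrow> x \<in> X \<Longrightarrow> proj M X x = x"
  by (rule proj_eqI) (auto dest: compl_subspace simp: subspace_0)

lemma proj_zero: "compl M X \<Longrightarrow> x \<in> M \<Longrightarrow> proj M X x = 0"
  by (rule proj_eqI) (auto dest: compl_subspace simp: subspace_0)

lemma proj_diff_proj_in:
  assumes "compl M X" "compl M Y"
  shows "proj M X u - proj M Y u \<in> M"
  using subspace_diff[OF compl_subspace(1)[OF assms(1)] proj_diff_in[OF assms(2), of u] proj_diff_in[OF assms(1), of u]]
  by simp

lemma proj_proj:
  assumes "compl M X" "compl M Y"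
  shows "proj M Y (proj M X u) = proj M Y u"
  using proj_eqI[OF assms(2) proj_in[OF assms(2)] proj_diff_proj_in[OF assms]] .

lemmas bil_simps = bilinear_ladd[OF bil] bilinear_radd[OF bil] bilinear_lsub[OF bil]
  bilinear_rsub[OF bil] bilinear_lmul[OF bil] bilinear_rmul[OF bil] bilinear_lzero[OF bil]
  bilinear_rzero[OF bil]

text \<open>The form \<open>rel_form M X Y\<close> is the extension of the chart value \<open>\<phi>\<^bsub>X,M\<^esub>(Y)\<close> from \<open>X\<close> to the whole
  space, with \<open>M\<close> in its radical. Having all these forms on one space makes those with the same \<open>M\<close>
  comparable: in an affine chart of Lagrangians transverse to \<open>M\<close>, it is the difference of the
  quadratic forms of \<open>Y\<close> and \<open>X\<close>.\<close>
definition rel_form :: "'a set \<Rightarrow> 'a set \<Rightarrow> 'a set \<Rightarrow> 'a \<Rightarrow> 'a \<Rightarrow> real" where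
  "rel_form M X Y u v = \<omega> (proj M Y u) (proj M X v)"

lemma isotropic_first: "compl M X \<Longrightarrow> u \<in> M \<Longrightarrow> v \<in> M \<Longrightarrow> \<omega> u v = 0"
  by (auto simp: compl_def intro: lagrangianD(3))

lemma isotropic_second: "compl M X \<Longrightarrow> u \<in> X \<Longrightarrow> v \<in> X \<Longrightarrow> \<omega> u v = 0"
  by (auto simp: compl_def intro: lagrangianD(3))

lemma rel_form_add:
  assumes X: "compl M X" and Y: "compl M Y" and Z: "compl M Z"
  shows "rel_form M X Y u v + rel_form M Y Z u v = rel_form M X Z u v"
proof -
  have "\<omega> (proj M Y u - proj M Z u) (proj M X v - proj M Y v) = 0"
    by (intro isotropic_first[OF X] proj_diff_proj_in assms)
  moreover have "\<omega> (proj M Y u) (proj M Y v) = 0"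
    by (intro isotropic_second[OF Y] proj_in Y)
  ultimately show ?thesis by (simp add: rel_form_def bil_simps)
qed

lemma rel_form_uminus:
  assumes "compl M X" "compl M Y"
  shows "rel_form M Y X u v = - rel_form M X Y u v"
proof -
  have "rel_form M X X u v = 0"
    unfolding rel_form_def by (intro isotropic_second[OF assms(1)] proj_in assms(1))
  then show ?thesis using rel_form_add[OF assms assms(1), of u v] by simp
qed

lemma bilinear_compose:
  fixes h :: "'c::real_vector \<Rightarrow> 'd::real_vector \<Rightarrow> 'e::real_vector"
  assumes "bilinear h" "linear f" "linear g" shows "bilinear (\<lambda>x y. h (f x) (g y))"
  using assms linear_compose[OF assms(2)] linear_compose[OF assms(3)]
  by (auto simp: bilinear_def o_def)

lemma bilinear_rel_form: "compl M X \<Longrightarrow> compl M Y \<Longrightarrow> bilinear (rel_form M X Y)"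
  unfolding rel_form_def[abs_def] using bilinear_compose[OF bil linear_proj linear_proj] .

lemma rel_form_symmetric:
  assumes "compl M X" "compl M Y"
  shows "symmetric_form (rel_form M X Y)"
proof -
  have "rel_form M X Y u v = rel_form M X Y v u" for u v
    using rel_form_uminus[OF assms, of v u] skew[of "proj M X v" "proj M Y u"]
    by (simp add: rel_form_def)
  then show ?thesis using bilinear_rel_form[OF assms] by (simp add: symmetric_form_def)
qed

lemma rel_form_radical: "compl M X \<Longrightarrow> compl M Y \<Longrightarrow> u \<in> M \<Longrightarrow> rel_form M X Y u v = 0"
  by (simp add: rel_form_def proj_zero bil_simps)

lemma rel_form_proj:
  assumes "compl M X" "compl M Y" "compl M Z"
  shows "rel_form M X Y (proj M Z u) (proj M Z v) = rel_form M X Y u v"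
  using assms by (simp add: rel_form_def proj_proj)

text \<open>The coindex of \<open>\<phi>\<^bsub>X,M\<^esub>(Y)\<close>, as \<open>pos_index_chart\<close> below confirms.\<close>
definition rel_index :: "'a set \<Rightarrow> 'a set \<Rightarrow> 'a set \<Rightarrow> int" where
  "rel_index M X Y = int (pos_index UNIV (rel_form M X Y))"

lemma graph_map_eq:
  assumes X: "compl M X" and Y: "compl M Y"
  shows "graph_map X M Y = (\<lambda>u. proj M Y u - proj M X u)"
  unfolding graph_map_def
proof (rule the_equality, intro conjI)
  let ?T = "\<lambda>u. proj M Y u - proj M X u"
  show "linear ?T" by (intro linear_compose_sub linear_proj X Y)
  show "?T ` X \<subseteq> M" using proj_diff_proj_in[OF Y X] by auto
  show "\<forall>y\<in>M. ?T y = 0" using X Y by (simp add: proj_zero)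
  have e: "x + ?T x = proj M Y x" if "x \<in> X" for x using that X by (simp add: proj_id)
  show "{x + ?T x |x. x \<in> X} = Y"
  proof
    show "{x + ?T x |x. x \<in> X} \<subseteq> Y" using e proj_in[OF Y] by auto
    show "Y \<subseteq> {x + ?T x |x. x \<in> X}"
    proof
      fix y assume "y \<in> Y"
      then have "y = proj M Y (proj M X y)" using X Y by (simp add: proj_proj proj_id)
      then have "y = proj M X y + ?T (proj M X y)" using e[OF proj_in[OF X]] by simp
      then show "y \<in> {x + ?T x |x. x \<in> X}" using proj_in[OF X] by blast
    qed
  qed
next
  fix T assume T: "linear T \<and> T ` X \<subseteq> M \<and> (\<forall>y\<in>M. T y = 0) \<and> {x + T x |x. x \<in> X} = Y"
  show "T = (\<lambda>u. proj M Y u - proj M X u)"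
  proof
    fix u
    define x where "x = proj M X u"
    have x: "x \<in> X" "u - x \<in> M" using proj_in[OF X] proj_diff_in[OF X] by (auto simp: x_def)
    have T: "linear T" "T ` X \<subseteq> M" "\<And>y. y \<in> M \<Longrightarrow> T y = 0" "{x + T x |x. x \<in> X} = Y"
      using T by auto
    have "T u = T x" using T(3)[OF x(2)] linear_diff[OF T(1), of u x] by simp
    moreover have "proj M Y x = x + T x"
    proof (rule proj_eqI[OF Y])
      show "x + T x \<in> Y" using T(4) x(1) by blast
      have "T x \<in> M" using T(2) x(1) by auto
      then show "x - (x + T x) \<in> M" using subspace_neg[OF compl_subspace(1)[OF X]] by simp
    qed
    moreover have "proj M Y x = proj M Y u" using proj_proj[OF X Y] by (simp add: x_def)
    ultimately show "T u = proj M Y u - proj M X u"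
      by (simp add: x_def eq_diff_eq add.commute)
  qed
qed

lemma chart_eq_rel_form:
  assumes "compl M X" "compl M Y" "x \<in> X" "y \<in> X"
  shows "chart \<omega> X M Y x y = rel_form M X Y x y"
  using isotropic_second[OF assms(1,3,4)] assms
  by (simp add: chart_def graph_map_eq rel_form_def proj_id bil_simps)

text \<open>A form on the whole space whose quadratic values factor through the projection onto \<open>X\<close> along
  \<open>M\<close> has the same coindex as its restriction to \<open>X\<close>, and \<open>C\<close> represents this restriction.\<close>
lemma pos_index_restrict:
  assumes X: "compl M X" and "B 0 0 = 0"
    and "\<And>u. B (proj M X u) (proj M X u) = B u u" "\<And>x. x \<in> X \<Longrightarrow> C x x = B x x"
  shows "pos_index X C = pos_index UNIV B"
proof (rule antisym)
  have z: "0 \<in> X" using compl_subspace(2)[OF X] by (rule subspace_0)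
  show "pos_index X C \<le> pos_index UNIV B"
    by (rule pos_index_pullback_le[of id]) (use z assms in \<open>auto simp: linear_id\<close>)
  show "pos_index UNIV B \<le> pos_index X C"
    by (rule pos_index_pullback_le[of "proj M X"])
      (use z assms in \<open>auto simp: proj_in linear_proj\<close>)
qed

lemma pos_index_chart:
  assumes X: "compl M X" and Y: "compl M Y"
  shows "int (pos_index X (chart \<omega> X M Y)) = rel_index M X Y"
proof -
  have "rel_form M X Y 0 0 = 0" using bilinear_rel_form[OF X Y] by (rule bilinear_lzero)
  then show ?thesis
    using pos_index_restrict[OF X, of "rel_form M X Y" "chart \<omega> X M Y"]
    by (simp add: rel_index_def rel_form_proj X Y chart_eq_rel_form)
qed

lemma rel_index_triangle:
  assumes "compl M X" "compl M Y" "compl M Z"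
  shows "rel_index M X Z \<le> rel_index M X Y + rel_index M Y Z"
proof -
  have "rel_form M X Z = (\<lambda>u v. rel_form M X Y u v + rel_form M Y Z u v)"
    using rel_form_add[OF assms] by (simp add: fun_eq_iff)
  then show ?thesis
    using pos_index_add_le[OF rel_form_symmetric[OF assms(1,2)] rel_form_symmetric[OF assms(2,3)]]
    by (simp add: rel_index_def)
qed

text \<open>The rank of \<open>rel_form M X Y\<close> is at most \<open>n - dim (X \<inter> Y)\<close>, where \<open>n\<close> is half the dimension: the
  radical contains \<open>M \<oplus> (X \<inter> Y)\<close>. The statement is doubled to avoid dividing the dimension.\<close>
lemma rel_index_swap_le:
  assumes X: "compl M X" and Y: "compl M Y"
  shows "2 * (rel_index M X Y + rel_index M Y X + int (dim (X \<inter> Y))) \<le> int DIM('a)"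
proof -
  note sM = compl_subspace(1)[OF X]
  have sXY: "subspace (X \<inter> Y)" using compl_subspace(2) X Y by (intro subspace_inter) auto
  let ?K = "{x + y |x y. x \<in> M \<and> y \<in> X \<inter> Y}"
  have dimM: "2 * dim M = DIM('a)" using X lagrangianD(2) by (auto simp: compl_def)
  have dK: "dim ?K = dim M + dim (X \<inter> Y)"
    by (rule dim_sums_trivial_Int[OF sM sXY]) (use X in \<open>auto simp: compl_def transverse_def\<close>)
  have "rel_form M Y X = (\<lambda>u v. - rel_form M X Y u v)"
    using rel_form_uminus[OF X Y] by (simp add: fun_eq_iff)
  moreover have "pos_index UNIV (rel_form M X Y) + pos_index UNIV (\<lambda>u v. - rel_form M X Y u v)
      + dim ?K \<le> DIM('a)"
  proof (rule pos_index_add_uminus_le[OF rel_form_symmetric[OF X Y] subspace_sums[OF sM sXY]])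
    fix k v assume "k \<in> ?K"
    then obtain m x where k: "k = m + x" "m \<in> M" "x \<in> X" "x \<in> Y" by auto
    have "rel_form M X Y x v = 0" using k(3,4) X Y isotropic_second[OF X k(3) proj_in[OF X]]
      by (simp add: rel_form_def proj_id)
    then show "rel_form M X Y k v = 0"
      using rel_form_radical[OF X Y k(2)] by (simp add: k(1) bilinear_ladd[OF bilinear_rel_form[OF X Y]])
  qed
  ultimately show ?thesis using dK dimM by (simp add: rel_index_def)
qed

lemma rel_index_swap_eq:
  assumes X: "compl M X" and Y: "compl M Y" and XY: "compl X Y"
  shows "2 * (rel_index M X Y + rel_index M Y X) = int DIM('a)"
proof -
  have dimM: "2 * dim M = DIM('a)" using X lagrangianD(2) by (auto simp: compl_def)
  have "rel_form M Y X = (\<lambda>u v. - rel_form M X Y u v)"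
    using rel_form_uminus[OF X Y] by (simp add: fun_eq_iff)
  moreover have "DIM('a) \<le> pos_index UNIV (rel_form M X Y)
      + pos_index UNIV (\<lambda>u v. - rel_form M X Y u v) + dim M"
  proof (rule pos_index_add_uminus_ge[OF rel_form_symmetric[OF X Y] compl_subspace(1)[OF X]])
    fix u assume u: "\<And>v. rel_form M X Y u v = 0"
    have "proj M Y u \<in> X"
    proof (rule lagrangian_perp)
      show "X \<in> lagrangians \<omega>" using X by (simp add: compl_def)
      fix w assume "w \<in> X"
      then show "\<omega> w (proj M Y u) = 0"
        using u[of w] X skew[of w "proj M Y u"] by (simp add: rel_form_def proj_id)
    qed
    then have "proj M Y u = 0" using XY proj_in[OF Y] by (auto simp: compl_def transverse_def)
    then show "u \<in> M" using proj_diff_in[OF Y, of u] by simp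
  qed
  ultimately show ?thesis using rel_index_swap_le[OF X Y] dimM by (simp add: rel_index_def)
qed

text \<open>The identity that governs a change of the transverse Lagrangian from \<open>M\<close> to \<open>N\<close>: the
  difference \<open>rel_index M X Y - rel_index N X Y\<close> equals \<open>rel_index M X N - rel_index M Y N\<close>, which is
  a function of \<open>X\<close> minus the same function of \<open>Y\<close>. With \<open>S\<close> and \<open>R\<close> representing \<open>Y\<close> and \<open>N\<close> relative
  to \<open>X\<close>, both sides compute the coindex of the block form with rows \<open>(S, S)\<close> and \<open>(S, R)\<close> on the
  square of the space. Eliminating the first block leaves \<open>R - S\<close>; eliminating the second leaves
  \<open>S - S A\<close>, where \<open>A\<close> solves \<open>R A = S\<close>, and this is \<open>\<phi>\<^bsub>X,N\<^esub>(Y)\<close> up to congruence.\<close>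
lemma rel_index_cocycle:
  assumes X: "compl M X" and Y: "compl M Y" and N: "compl M N"
    and NX: "compl N X" and NY: "compl N Y"
  shows "rel_index M X Y + rel_index M Y N = rel_index N X Y + rel_index M X N"
proof -
  define S where "S = rel_form M X Y"
  define R where "R = rel_form M X N"
  define T where "T = rel_form M Y N"
  \<comment> \<open>\<open>R\<close> is degenerate on the whole space, so the solution \<open>A\<close> of \<open>R (A u) v = S u v\<close> is given
     explicitly, with values in \<open>X\<close>.\<close>
  define A where "A = (\<lambda>u. proj M X u - proj N X (proj M Y u))"
  define E where "E = (\<lambda>u v. rel_form N X Y (proj M Y u) (proj M Y v))"
  have symS: "symmetric_form S" unfolding S_def by (rule rel_form_symmetric[OF X Y])
  have symR: "symmetric_form R" unfolding R_def by (rule rel_form_symmetric[OF X N])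
  have symT: "symmetric_form T" unfolding T_def by (rule rel_form_symmetric[OF Y N])
  have symE: "symmetric_form E" unfolding E_def symmetric_form_def
    using rel_form_symmetric[OF NX NY]
      bilinear_compose[OF bilinear_rel_form[OF NX NY] linear_proj[OF Y] linear_proj[OF Y]]
    by (simp add: symmetric_form_def)
  have linA: "linear A" unfolding A_def
    using linear_compose[OF linear_proj[OF Y] linear_proj[OF NX]]
    by (intro linear_compose_sub linear_proj X) (simp add: o_def)
  have AX: "A u \<in> X" for u unfolding A_def
    by (intro subspace_diff compl_subspace(2)[OF X] proj_in X NX)
  have pNA: "proj M N (A u) = proj M Y u - proj N X (proj M Y u)" for u
  proof (rule proj_eqI[OF N proj_diff_in[OF NX]])
    show "A u - (proj M Y u - proj N X (proj M Y u)) \<in> M"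
      using proj_diff_proj_in[OF X Y, of u] by (simp add: A_def)
  qed
  have RA: "R (A u) v = S u v" for u v
    using isotropic_second[OF X proj_in[OF NX] proj_in[OF X]]
    by (simp add: R_def S_def rel_form_def pNA bil_simps)
  have E: "E u v = S u v - S u (A v)" for u v
    unfolding E_def S_def rel_form_def using X Y NY NX AX[of v]
    by (simp add: proj_id proj_in) (simp add: A_def bil_simps)
  have T: "T u v = R u v - S u v" for u v
    using rel_form_add[OF X Y N, of u v] by (simp add: R_def S_def T_def)
  let ?G1 = "\<lambda>p q. S (fst p) (fst q) + T (snd p) (snd q)"
  let ?G2 = "\<lambda>p q. E (fst p) (fst q) + R (snd p) (snd q)"
  have bS: "bilinear S" and sS: "\<And>x y. S x y = S y x" using symS by (auto simp: symmetric_form_def)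
  have bR: "bilinear R" and sR: "\<And>x y. R x y = R y x" using symR by (auto simp: symmetric_form_def)
  note bSR = bilinear_ladd[OF bS] bilinear_radd[OF bS] bilinear_lsub[OF bS] bilinear_rsub[OF bS]
    bilinear_ladd[OF bR] bilinear_radd[OF bR] bilinear_lsub[OF bR] bilinear_rsub[OF bR]
  \<comment> \<open>Both diagonal forms are the quadratic form \<open>S(u,u) + 2 S(u,v) + R(v,v)\<close>, once with the
     square completed in \<open>u\<close> and once in \<open>v\<close>.\<close>
  have key: "?G1 (u + v, v) (u + v, v) = ?G2 (u, v + A u) (u, v + A u)" for u v
    using sS[of u v] sS[of u "A u"] sR[of v "A u"] by (simp add: E T bSR RA)
  have z: "S 0 0 = 0" "R 0 0 = 0" "T 0 0 = 0" "E 0 0 = 0"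
    using symS symR symT symE by (auto simp: symmetric_form_def bilinear_lzero)
  have "pos_index UNIV ?G1 \<le> pos_index UNIV ?G2"
  proof (rule pos_index_pullback_le[of "\<lambda>p. (fst p - snd p, snd p + A (fst p - snd p))"])
    show "linear (\<lambda>p. (fst p - snd p, snd p + A (fst p - snd p)))"
      using linA by (auto intro!: linearI simp: linear_add linear_diff linear_cmul algebra_simps)
    fix p
    show "?G2 (fst p - snd p, snd p + A (fst p - snd p)) (fst p - snd p, snd p + A (fst p - snd p)) = ?G1 p p"
      using key[of "fst p - snd p" "snd p"] by simp
  qed (use z in auto)
  moreover have "pos_index UNIV ?G2 \<le> pos_index UNIV ?G1"
  proof (rule pos_index_pullback_le[of "\<lambda>p. (fst p + (snd p - A (fst p)), snd p - A (fst p))"])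
    show "linear (\<lambda>p. (fst p + (snd p - A (fst p)), snd p - A (fst p)))"
      using linA by (auto intro!: linearI simp: linear_add linear_diff linear_cmul algebra_simps)
    fix p
    show "?G1 (fst p + (snd p - A (fst p)), snd p - A (fst p)) (fst p + (snd p - A (fst p)), snd p - A (fst p)) = ?G2 p p"
      using key[of "fst p" "snd p - A (fst p)"] by simp
  qed (use z in auto)
  moreover have "pos_index UNIV E = pos_index UNIV (rel_form N X Y)"
  proof (rule antisym)
    have z': "rel_form N X Y 0 0 = 0" using bilinear_rel_form[OF NX NY] by (rule bilinear_lzero)
    show "pos_index UNIV E \<le> pos_index UNIV (rel_form N X Y)"
      by (rule pos_index_pullback_le[of "proj M Y"]) (auto simp: E_def z' linear_proj[OF Y])
    show "pos_index UNIV (rel_form N X Y) \<le> pos_index UNIV E"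
    proof (rule pos_index_pullback_le[of "proj N Y"])
      fix u
      show "E (proj N Y u) (proj N Y u) = rel_form N X Y u u"
        by (simp add: E_def proj_id[OF Y proj_in[OF NY]] rel_form_proj[OF NX NY NY])
    qed (auto simp: linear_proj[OF NY] z)
  qed
  ultimately show ?thesis
    using pos_index_orthogonal_sum[OF symS symT] pos_index_orthogonal_sum[OF symE symR]
    by (simp add: rel_index_def S_def R_def T_def)
qed

end

section \<open>Common transverse Lagrangians\<close>

lemma subspace_avoids_finite_Union:
  fixes E :: "'a::real_vector set"
  assumes "finite \<S>" "subspace E" "\<And>S. S \<in> \<S> \<Longrightarrow> subspace S \<and> \<not> E \<subseteq> S"
  shows "\<exists>v\<in>E. \<forall>S\<in>\<S>. v \<notin> S"
  using assms(1,3)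
proof (induction \<S> rule: finite_induct)
  case empty
  then show ?case using subspace_0[OF assms(2)] by auto
next
  case (insert S \<S>)
  then obtain v where v: "v \<in> E" "\<And>T. T \<in> \<S> \<Longrightarrow> v \<notin> T" by auto
  obtain w where w: "w \<in> E" "w \<notin> S" using insert.prems by blast
  \<comment> \<open>Each member contains at most one point of the line \<open>v + t w\<close>.\<close>
  have inj: "t = t'" if T: "T \<in> insert S \<S>" and t: "v + t *\<^sub>R w \<in> T" "v + t' *\<^sub>R w \<in> T" for T and t t' :: real
  proof (rule ccontr)
    assume ne: "t \<noteq> t'"
    have s: "subspace T" using insert.prems T by auto
    have "(v + t *\<^sub>R w) - (v + t' *\<^sub>R w) \<in> T" using subspace_diff[OF s t] .
    then have "(t - t') *\<^sub>R w \<in> T" by (simp add: algebra_simps)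
    then have "inverse (t - t') *\<^sub>R ((t - t') *\<^sub>R w) \<in> T" by (rule subspace_mul[OF s])
    then have wT: "w \<in> T" using ne by simp
    then have "(v + t *\<^sub>R w) - t *\<^sub>R w \<in> T" by (intro subspace_diff[OF s t(1)] subspace_mul[OF s])
    then have "v \<in> T" by simp
    then show False using T v(2) w(2) wT by auto
  qed
  define bad where "bad = (\<Union>T\<in>insert S \<S>. {t::real. v + t *\<^sub>R w \<in> T})"
  have "finite {t::real. v + t *\<^sub>R w \<in> T}" if T: "T \<in> insert S \<S>" for T
  proof (cases "\<exists>t::real. v + t *\<^sub>R w \<in> T")
    case True
    then obtain t :: real where "v + t *\<^sub>R w \<in> T" by blast
    then have "{t::real. v + t *\<^sub>R w \<in> T} \<subseteq> {t}" using inj[OF T] by blast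
    then show ?thesis by (rule finite_subset) simp
  qed simp
  then have "finite bad" unfolding bad_def using insert.hyps by (intro finite_UN_I) auto
  then obtain t :: real where "t \<notin> bad" using ex_new_if_finite infinite_UNIV_char_0 by blast
  then have "\<forall>T\<in>insert S \<S>. v + t *\<^sub>R w \<notin> T" by (auto simp: bad_def)
  moreover have "v + t *\<^sub>R w \<in> E"
    by (intro subspace_add[OF assms(2)] subspace_mul[OF assms(2)] v w)
  ultimately show ?case by blast
qed

context symplectic_space
begin

text \<open>If the orthogonal of \<open>W\<close> were contained in \<open>W + L\<close>, its intersection with \<open>L\<close>, nonzero by dimension,
  would be orthogonal to it and hence contained in \<open>W\<close>.\<close>
lemma perp_not_subset_sum:
  assumes W: "subspace W"
    and d: "2 * dim W < DIM('a)" and L: "L \<in> lagrangians \<omega>" and WL: "W \<inter> L \<subseteq> {0}"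
  shows "\<not> {v. \<forall>w\<in>W. \<omega> w v = 0} \<subseteq> {x + y |x y. x \<in> W \<and> y \<in> L}"
proof
  let ?P = "{v. \<forall>w\<in>W. \<omega> w v = 0}"
  assume sub: "?P \<subseteq> {x + y |x y. x \<in> W \<and> y \<in> L}"
  have "dim (?P \<inter> L) > 0"
    using dim_Int_ge[OF subspace_perp[of W] lagrangianD(1)[OF L]] lagrangianD(2)[OF L]
      dim_perp[OF W] d by linarith
  then have "\<not> ?P \<inter> L \<subseteq> {0}" using dim_eq_0[of "?P \<inter> L"] by linarith
  then obtain v where v: "v \<in> ?P" "v \<in> L" "v \<noteq> 0" by blast
  have "v \<in> W"
  proof (rule perp_perp[OF W])
    fix p assume "\<And>w. w \<in> W \<Longrightarrow> \<omega> w p = 0"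
    then have "p \<in> ?P" by blast
    then have "p \<in> {x + y |x y. x \<in> W \<and> y \<in> L}" using sub by (rule subsetD[rotated])
    then obtain w l where p: "p = w + l" "w \<in> W" "l \<in> L" by blast
    then show "\<omega> p v = 0" using v lagrangianD(3)[OF L p(3) v(2)]
      by (simp add: bilinear_ladd[OF bil])
  qed
  then show False using v WL by blast
qed

text \<open>An isotropic subspace of maximal dimension among those meeting every member of \<open>\<L>\<close> trivially is
  Lagrangian: otherwise it could be enlarged by a vector of its symplectic orthogonal, which is
  not covered by \<open>W\<close> and the finitely many subspaces \<open>W + L\<close>, since it lies in none of them.\<close>
lemma common_complement:
  assumes "finite \<L>" "\<L> \<subseteq> lagrangians \<omega>"
  obtains M where "\<And>L. L \<in> \<L> \<Longrightarrow> compl M L" "M \<in> lagrangians \<omega>"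
proof -
  define good where "good W \<longleftrightarrow> subspace W \<and> (\<forall>x\<in>W. \<forall>y\<in>W. \<omega> x y = 0) \<and> (\<forall>L\<in>\<L>. W \<inter> L \<subseteq> {0})" for W
  have "good {0}" by (simp add: good_def bil_simps)
  then have "Max {dim W |W. good W} \<in> {dim W |W. good W}"
    by (intro Max_in finite_dims) blast
  then obtain W where W: "good W" "dim W = Max {dim W |W. good W}" by auto
  have max: "dim W' \<le> dim W" if "good W'" for W'
    unfolding W(2) by (rule Max_ge[OF finite_dims]) (use that in blast)
  have sW: "subspace W" and iW: "\<And>x y. x \<in> W \<Longrightarrow> y \<in> W \<Longrightarrow> \<omega> x y = 0"
    and tW: "\<And>L. L \<in> \<L> \<Longrightarrow> W \<inter> L \<subseteq> {0}" using W(1) by (auto simp: good_def)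
  let ?P = "{v. \<forall>w\<in>W. \<omega> w v = 0}"
  let ?WL = "\<lambda>L. {x + y |x y. x \<in> W \<and> y \<in> L}"
  have "W \<subseteq> ?P" using iW by blast
  then have le: "2 * dim W \<le> DIM('a)" using dim_perp[OF sW] dim_subset[of W ?P] by linarith
  have "2 * dim W = DIM('a)"
  proof (rule ccontr)
    assume "2 * dim W \<noteq> DIM('a)"
    then have lt: "2 * dim W < DIM('a)" using le by simp
    have "\<not> ?P \<subseteq> W" using dim_subset[of ?P W] dim_perp[OF sW] lt by linarith
    moreover have "subspace (?WL L) \<and> \<not> ?P \<subseteq> ?WL L" if "L \<in> \<L>" for L
    proof
      have L: "L \<in> lagrangians \<omega>" using that assms(2) by blast
      show "subspace (?WL L)" by (rule subspace_sums[OF sW lagrangianD(1)[OF L]])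
      show "\<not> ?P \<subseteq> ?WL L" by (rule perp_not_subset_sum[OF sW lt L tW[OF that]])
    qed
    ultimately have "\<exists>v\<in>?P. \<forall>S\<in>insert W (?WL ` \<L>). v \<notin> S"
      using assms(1) sW by (intro subspace_avoids_finite_Union subspace_perp) auto
    then obtain v where v': "v \<in> ?P" "\<forall>S\<in>insert W (?WL ` \<L>). v \<notin> S" by (rule bexE)
    have v: "v \<in> ?P" "v \<notin> W" using v' by simp_all
    have vL: "v \<notin> ?WL L" if "L \<in> \<L>" for L by (rule bspec[OF v'(2)]) (use that in simp)
    have el: "\<exists>w\<in>W. \<exists>c. x = w + c *\<^sub>R v" if x: "x \<in> span (insert v W)" for x
    proof -
      obtain k where "x - k *\<^sub>R v \<in> W" using x sW by (auto simp: span_insert span_eq_iff[THEN iffD2])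
      moreover have "x = (x - k *\<^sub>R v) + k *\<^sub>R v" by simp
      ultimately show ?thesis by blast
    qed
    have vv: "\<omega> v v = 0" using skew[of v v] by simp
    have wv: "\<omega> w v = 0" "\<omega> v w = 0" if "w \<in> W" for w 
      using v(1) that skew[of v w] by simp_all
    have "good (span (insert v W))"
      unfolding good_def
    proof (intro conjI ballI subsetI)
      fix x y assume "x \<in> span (insert v W)" "y \<in> span (insert v W)"
      then obtain w c w' c' where "x = w + c *\<^sub>R v" "y = w' + c' *\<^sub>R v" "w \<in> W" "w' \<in> W"
        using el[of x] el[of y] by blast
      then show "\<omega> x y = 0" using iW vv wv by (simp add: bil_simps)
    next
      fix L x assume L: "L \<in> \<L>" and x: "x \<in> span (insert v W) \<inter> L"
      then obtain w c where w: "x = w + c *\<^sub>R v" "w \<in> W" using el by blast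
      have sL: "subspace L" using L assms(2) lagrangianD(1) by blast
      have "c = 0"
      proof (rule ccontr)
        assume c: "c \<noteq> 0"
        have "v = inverse c *\<^sub>R (- w) + inverse c *\<^sub>R x" using c by (simp add: w(1) algebra_simps)
        moreover have "inverse c *\<^sub>R (- w) \<in> W" "inverse c *\<^sub>R x \<in> L"
          using subspace_mul[OF sW subspace_neg[OF sW w(2)]] subspace_mul[OF sL] x by auto
        ultimately have "v \<in> ?WL L" by blast
        then show False using vL[OF L] by (rule notE[rotated])
      qed
      then show "x \<in> {0}" using tW[OF L] w x by auto
    qed simp
    then have "dim (span (insert v W)) \<le> dim W" by (rule max)
    then show False using v(2) sW by (simp add: dim_span dim_insert span_eq_iff[THEN iffD2])
  qed
  then have WL: "W \<in> lagrangians \<omega>" using sW iW by (simp add: lagrangians_def)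
  have "compl W L" if "L \<in> \<L>" for L
  proof -
    have "L \<in> lagrangians \<omega>" using that assms(2) by blast
    moreover from this have "0 \<in> W \<inter> L" using sW lagrangianD(1) subspace_0 by blast
    ultimately show ?thesis using tW[OF that] WL by (auto simp: compl_def transverse_def)
  qed
  then show ?thesis using that WL by blast
qed

section \<open>Local constancy and change of chart\<close>

lemma topspace_lagrangian_topology: "topspace (lagrangian_topology \<omega>) \<subseteq> lagrangians \<omega>"
  by (auto simp: lagrangian_topology_def topology_generated_by_topspace transverse_lagrangians_def)

lemma transverse_lagrangians_eq: "M \<in> lagrangians \<omega> \<Longrightarrow> L \<in> transverse_lagrangians \<omega> M \<longleftrightarrow> compl M L"
  by (auto simp: transverse_lagrangians_def compl_def transverse_def)

lemma openin_chart:
  assumes "compl M X" "open U"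
  shows "openin (lagrangian_topology \<omega>) {L. compl M L \<and> chart \<omega> X M L \<in> U}"
proof -
  have M: "M \<in> lagrangians \<omega>" and X: "X \<in> lagrangians \<omega>" and t: "transverse X M"
    using assms(1) by (auto simp: compl_def transverse_def)
  have eq: "{L. compl M L \<and> chart \<omega> X M L \<in> U} = {L \<in> transverse_lagrangians \<omega> M. chart \<omega> X M L \<in> U}"
    using transverse_lagrangians_eq[OF M] by auto
  show ?thesis unfolding eq lagrangian_topology_def
    by (rule topology_generated_by_Basis) (use M X t assms(2) in blast)
qed

lemma openin_compl:
  assumes "M \<in> lagrangians \<omega>"
  shows "openin (lagrangian_topology \<omega>) {L. compl M L}"
proof -
  obtain X where "compl X M" using common_complement[of "{M}"] assms by auto
  then show ?thesis using openin_chart[OF compl_sym, of X M UNIV] by simp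
qed

text \<open>Near \<open>Y\<close> the chart value stays positive on the positive, and negative on the negative subspace
  of the nondegenerate form \<open>\<phi>\<^bsub>X,M\<^esub>(Y)\<close>. So neither index can drop, and since their sum is already
  maximal at \<open>Y\<close>, neither can rise. The varying Lagrangian stands in the base position of
  \<open>rel_index M L X\<close>, as in the cocycle identity.\<close>
lemma rel_index_locally_constant:
  assumes X: "compl M X" and Y: "compl M Y" and XY: "compl X Y"
  obtains \<U> where "openin (lagrangian_topology \<omega>) \<U>" "Y \<in> \<U>"
    "\<And>L. L \<in> \<U> \<Longrightarrow> compl M L \<and> rel_index M L X = rel_index M Y X"
proof -
  let ?c = "chart \<omega> X M Y"
  have X0: "0 \<in> X" using compl_subspace(2)[OF X] by (rule subspace_0)
  have z: "rel_form M X Y 0 0 = 0" "rel_form M Y X 0 0 = 0"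
    using bilinear_rel_form[OF X Y] bilinear_rel_form[OF Y X] by (auto intro: bilinear_lzero)
  obtain P where P: "subspace P" "P \<subseteq> X" "\<And>x. x \<in> P \<Longrightarrow> x \<noteq> 0 \<Longrightarrow> 0 < rel_form M X Y x x"
    "dim P = pos_index X (rel_form M X Y)" by (rule pos_index_attained[OF X0]) (rule that; assumption)
  obtain N where N: "subspace N" "N \<subseteq> X" "\<And>x. x \<in> N \<Longrightarrow> x \<noteq> 0 \<Longrightarrow> 0 < rel_form M Y X x x"
    "dim N = pos_index X (rel_form M Y X)" by (rule pos_index_attained[OF X0]) (rule that; assumption)
  have dP: "int (dim P) = rel_index M X Y"
    unfolding P(4) rel_index_def using z X Y by (subst pos_index_restrict[OF X]) (simp_all add: rel_form_proj)
  have dN: "int (dim N) = rel_index M Y X"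
    unfolding N(4) rel_index_def using z X Y by (subst pos_index_restrict[OF X]) (simp_all add: rel_form_proj)
  have ch: "chart \<omega> X M L x y = rel_form M X L x y" "- chart \<omega> X M L x y = rel_form M L X x y"
    if "compl M L" "x \<in> X" "y \<in> X" for L x y
    using that X by (simp_all add: chart_eq_rel_form rel_form_uminus[OF X])
  have qP: "?c x y = rel_form M X Y x y" if "x \<in> P" "y \<in> P" for x y
    using that P(2) by (intro ch Y) auto
  have qN: "- ?c x y = rel_form M Y X x y" if "x \<in> N" "y \<in> N" for x y
    using that N(2) by (intro ch Y) auto
  obtain U where U: "open U" "?c \<in> U"
    "\<And>C x. bilinear C \<Longrightarrow> (\<exists>q'\<in>U. \<forall>x\<in>P. \<forall>y\<in>P. q' x y = C x y) \<Longrightarrow> x \<in> P \<Longrightarrow> x \<noteq> 0 \<Longrightarrow> 0 < C x x"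
    by (rule positive_definite_stable[OF bilinear_rel_form[OF X Y] P(1,3) qP]) (assumption | rule that; assumption)+
  obtain V where V: "open V" "(\<lambda>x y. - ?c x y) \<in> V"
    "\<And>C x. bilinear C \<Longrightarrow> (\<exists>q'\<in>V. \<forall>x\<in>N. \<forall>y\<in>N. q' x y = C x y) \<Longrightarrow> x \<in> N \<Longrightarrow> x \<noteq> 0 \<Longrightarrow> 0 < C x x"
    by (rule positive_definite_stable[where q = "\<lambda>x y. - ?c x y", OF bilinear_rel_form[OF Y X] N(1,3) qN])
      (assumption | rule that; assumption)+
  let ?m = "\<lambda>q::'a \<Rightarrow> 'a \<Rightarrow> real. \<lambda>x y. - q x y"
  have "continuous_on UNIV ?m"
    by (intro continuous_on_coordinatewise_then_product continuous_on_minus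
        continuous_on_product_then_coordinatewise[OF continuous_on_product_coordinates])
  then have "open (?m -` V)" using V(1) by (simp add: open_vimage)
  then have oUV: "open (U \<inter> ?m -` V)" using U(1) by blast
  show thesis
  proof (rule that)
    show "openin (lagrangian_topology \<omega>) {L. compl M L \<and> chart \<omega> X M L \<in> U \<inter> ?m -` V}"
      by (rule openin_chart[OF X oUV])
    show "Y \<in> {L. compl M L \<and> chart \<omega> X M L \<in> U \<inter> ?m -` V}" using U(2) V(2) Y by simp
    fix L assume "L \<in> {L. compl M L \<and> chart \<omega> X M L \<in> U \<inter> ?m -` V}"
    then have L: "compl M L" "chart \<omega> X M L \<in> U" "(\<lambda>x y. - chart \<omega> X M L x y) \<in> V" by auto
    have "dim P \<le> pos_index UNIV (rel_form M X L)"
    proof (rule dim_le_pos_index[OF P(1) subset_UNIV])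
      fix x assume "x \<in> P" "x \<noteq> 0"
      moreover have "\<exists>q'\<in>U. \<forall>x\<in>P. \<forall>y\<in>P. q' x y = rel_form M X L x y"
        using L(1) P(2) by (intro bexI[OF _ L(2)] ballI ch) auto
      ultimately show "0 < rel_form M X L x x" by (intro U(3) bilinear_rel_form X L(1))
    qed
    moreover have "dim N \<le> pos_index UNIV (rel_form M L X)"
    proof (rule dim_le_pos_index[OF N(1) subset_UNIV])
      fix x assume "x \<in> N" "x \<noteq> 0"
      moreover have "\<exists>q'\<in>V. \<forall>x\<in>N. \<forall>y\<in>N. q' x y = rel_form M L X x y"
        using L(1) N(2) by (intro bexI[OF _ L(3)] ballI ch) auto
      ultimately show "0 < rel_form M L X x x" by (intro V(3) bilinear_rel_form X L(1))
    qed
    ultimately have "rel_index M X Y \<le> rel_index M X L" "rel_index M Y X \<le> rel_index M L X"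
      using dP dN by (simp_all add: rel_index_def)
    moreover have "rel_index M X L + rel_index M L X \<le> rel_index M X Y + rel_index M Y X"
    proof -
      have "2 * (rel_index M X L + rel_index M L X)
          \<le> 2 * (rel_index M X L + rel_index M L X + int (dim (X \<inter> L)))" by simp
      also have "\<dots> \<le> int DIM('a)" by (rule rel_index_swap_le[OF X L(1)])
      also have "\<dots> = 2 * (rel_index M X Y + rel_index M Y X)"
        by (rule rel_index_swap_eq[OF X Y XY, symmetric])
      finally show ?thesis by simp
    qed
    ultimately have "rel_index M L X = rel_index M Y X" by linarith
    then show "compl M L \<and> rel_index M L X = rel_index M Y X" using L(1) by simp
  qed
qed

text \<open>The increments of the coindex in two different charts agree for nearby Lagrangians. If \<open>M\<close> and \<open>N\<close> are
  transverse this is the cocycle identity; in general one passes through a common complement.\<close>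
lemma rel_index_change_locally_constant:
  assumes "compl M X" "compl N X" "compl M Y" "compl N Y"
  obtains \<U> where "openin (lagrangian_topology \<omega>) \<U>" "Y \<in> \<U>"
    "\<And>L. L \<in> \<U> \<Longrightarrow> compl M L \<and> compl N L \<and>
       rel_index M X L - rel_index N X L = rel_index M X Y - rel_index N X Y"
proof -
  have step: "\<exists>\<U>. openin (lagrangian_topology \<omega>) \<U> \<and> Y \<in> \<U> \<and> (\<forall>L\<in>\<U>. compl M L \<and> compl N L \<and>
       rel_index M X L - rel_index N X L = rel_index M X Y - rel_index N X Y)"
    if c: "compl M X" "compl N X" "compl M Y" "compl N Y" "compl M N" for M N
  proof -
    obtain \<U> where U: "openin (lagrangian_topology \<omega>) \<U>" "Y \<in> \<U>"
      "\<And>L. L \<in> \<U> \<Longrightarrow> compl M L \<and> rel_index M L N = rel_index M Y N"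
      by (rule rel_index_locally_constant[OF c(5,3,4)]) (rule that; assumption)
    have N: "N \<in> lagrangians \<omega>" using c by (simp add: compl_def)
    show ?thesis
    proof (intro exI conjI ballI)
      show "openin (lagrangian_topology \<omega>) (\<U> \<inter> {L. compl N L})"
        by (rule openin_Int[OF U(1) openin_compl[OF N]])
      show "Y \<in> \<U> \<inter> {L. compl N L}" using U(2) c(4) by simp
      fix L assume "L \<in> \<U> \<inter> {L. compl N L}"
      then have L: "compl M L" "compl N L" "rel_index M L N = rel_index M Y N" using U(3)[of L] by auto
      show "compl M L" "compl N L" by (rule L)+
      show "rel_index M X L - rel_index N X L = rel_index M X Y - rel_index N X Y"
        using rel_index_cocycle[OF c(1) L(1) c(5,2) L(2)] rel_index_cocycle[OF c(1,3,5,2,4)] L(3)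
        by linarith
    qed
  qed
  obtain K where K: "\<And>L. L \<in> {M, N, X, Y} \<Longrightarrow> compl K L"
    by (rule common_complement[of "{M, N, X, Y}"]) (use assms in \<open>auto simp: compl_def\<close>)
  obtain \<U> where U: "openin (lagrangian_topology \<omega>) \<U>" "Y \<in> \<U>" "\<And>L. L \<in> \<U> \<Longrightarrow> compl M L \<and>
       rel_index M X L - rel_index K X L = rel_index M X Y - rel_index K X Y"
    using step[OF assms(1) K[of X] assms(3) K[of Y] compl_sym[OF K[of M]]] by auto
  obtain \<V> where V: "openin (lagrangian_topology \<omega>) \<V>" "Y \<in> \<V>" "\<And>L. L \<in> \<V> \<Longrightarrow> compl N L \<and>
       rel_index N X L - rel_index K X L = rel_index N X Y - rel_index K X Y"
    using step[OF assms(2) K[of X] assms(4) K[of Y] compl_sym[OF K[of N]]] by auto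
  show thesis
  proof (rule that[OF openin_Int[OF U(1) V(1)]])
    show "Y \<in> \<U> \<inter> \<V>" using U V by simp
    fix L assume "L \<in> \<U> \<inter> \<V>"
    then show "compl M L \<and> compl N L \<and>
       rel_index M X L - rel_index N X L = rel_index M X Y - rel_index N X Y"
      using U(3)[of L] V(3)[of L] by simp
  qed
qed

section \<open>The Hoermander index\<close>

text \<open>The Hoermander index of two pairs of Lagrangians, computed with an auxiliary Lagrangian \<open>M\<close>
  transverse to all four.\<close>
definition hormander_index :: "'a set \<Rightarrow> 'a set \<Rightarrow> 'a set \<Rightarrow> 'a set \<Rightarrow> 'a set \<Rightarrow> int" where
  "hormander_index M X X' A B =
    (rel_index M X B - rel_index M X A) - (rel_index M X' B - rel_index M X' A)"

lemma hormander_index_indep: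
  assumes "\<And>L. L \<in> {X, X', A, B} \<Longrightarrow> compl M L" "\<And>L. L \<in> {X, X', A, B} \<Longrightarrow> compl N L"
  shows "hormander_index M X X' A B = hormander_index N X X' A B"
proof -
  have step: "hormander_index M X X' A B = hormander_index N X X' A B"
    if c: "compl M N" "\<And>L. L \<in> {X, X', A, B} \<Longrightarrow> compl M L" "\<And>L. L \<in> {X, X', A, B} \<Longrightarrow> compl N L" for M N
    using rel_index_cocycle[OF c(2)[of X] c(2)[of A] c(1) c(3)[of X] c(3)[of A]]
      rel_index_cocycle[OF c(2)[of X] c(2)[of B] c(1) c(3)[of X] c(3)[of B]]
      rel_index_cocycle[OF c(2)[of X'] c(2)[of A] c(1) c(3)[of X'] c(3)[of A]]
      rel_index_cocycle[OF c(2)[of X'] c(2)[of B] c(1) c(3)[of X'] c(3)[of B]]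
    by (simp add: hormander_index_def)
  obtain K where K: "\<And>L. L \<in> {M, N, X, X', A, B} \<Longrightarrow> compl K L"
    by (rule common_complement[of "{M, N, X, X', A, B}"])
      (use assms(1)[of X] assms(2)[of X] assms(1)[of X'] assms(1)[of A] assms(1)[of B] in \<open>auto simp: compl_def\<close>)
  have "hormander_index K X X' A B = hormander_index M X X' A B"
    by (rule step) (use K assms in auto)
  moreover have "hormander_index K X X' A B = hormander_index N X X' A B"
    by (rule step) (use K assms in auto)
  ultimately show ?thesis by simp
qed

text \<open>By the triangle inequality the two differences are bounded by the coindices of \<open>\<phi>\<^bsub>A,M\<^esub>(B)\<close> and
  \<open>\<phi>\<^bsub>B,M\<^esub>(A)\<close>, and these add up to at most the rank.\<close>
lemma hormander_index_le:
  assumes "\<And>L. L \<in> {X, X', A, B} \<Longrightarrow> compl M L"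
  shows "2 * (hormander_index M X X' A B + int (dim (A \<inter> B))) \<le> int DIM('a)"
  using rel_index_triangle[OF assms[of X] assms[of A] assms[of B]]
    rel_index_triangle[OF assms[of X'] assms[of B] assms[of A]]
    rel_index_swap_le[OF assms[of A] assms[of B]]
  by (simp add: hormander_index_def)

end

section \<open>Construction of the Maslov index\<close>

text \<open>Bolzano bisection for a property that only concerns subintervals of a fixed interval.\<close>
lemma subinterval_induct [consumes 1, case_names trans local]:
  fixes a b :: real
  assumes "a \<le> b"
    and trans: "\<And>p q r. a \<le> p \<Longrightarrow> p \<le> q \<Longrightarrow> q \<le> r \<Longrightarrow> r \<le> b \<Longrightarrow> P p q \<Longrightarrow> P q r \<Longrightarrow> P p r"
    and loc: "\<And>t. a \<le> t \<Longrightarrow> t \<le> b \<Longrightarrow>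
      \<exists>\<delta>>0. \<forall>c d. a \<le> c \<and> c \<le> t \<and> t \<le> d \<and> d \<le> b \<and> d - c < \<delta> \<longrightarrow> P c d"
  shows "P a b"
proof -
  have "a \<le> a \<longrightarrow> b \<le> b \<longrightarrow> P a b"
  proof (rule Bolzano[OF assms(1), where P = "\<lambda>c d. a \<le> c \<longrightarrow> d \<le> b \<longrightarrow> P c d"])
    fix p q r assume "a \<le> p \<longrightarrow> q \<le> b \<longrightarrow> P p q" "a \<le> q \<longrightarrow> r \<le> b \<longrightarrow> P q r" "p \<le> q" "q \<le> r"
    then show "a \<le> p \<longrightarrow> r \<le> b \<longrightarrow> P p r" using trans[of p q r] by (meson order_trans)
  next
    fix t assume t: "a \<le> t" "t \<le> b"
    obtain \<delta> where "\<delta> > 0" "\<forall>c d. a \<le> c \<and> c \<le> t \<and> t \<le> d \<and> d \<le> b \<and> d - c < \<delta> \<longrightarrow> P c d"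
      using loc[OF t] by blast
    then show "\<exists>\<delta>>0. \<forall>c d. c \<le> t \<and> t \<le> d \<and> d - c < \<delta> \<longrightarrow> a \<le> c \<longrightarrow> d \<le> b \<longrightarrow> P c d"
      by blast
  qed
  then show ?thesis by simp
qed

lemma continuous_map_top_of_set_nbhd:
  fixes S :: "'a::metric_space set"
  assumes "continuous_map (top_of_set S) T f" "openin T U" "x \<in> S" "f x \<in> U"
  obtains \<delta> where "\<delta> > 0" "\<And>y. y \<in> S \<Longrightarrow> dist y x < \<delta> \<Longrightarrow> f y \<in> U"
proof -
  have "openin (top_of_set S) {y \<in> topspace (top_of_set S). f y \<in> U}"
    using assms(1,2) by (rule openin_continuous_map_preimage)
  then have "\<exists>e>0. \<forall>y\<in>S. dist y x < e \<longrightarrow> f y \<in> U"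
    using assms(3,4) by (auto simp: openin_euclidean_subtopology_iff)
  then show ?thesis using that by blast
qed

context symplectic_space
begin

abbreviation is_path :: "real \<Rightarrow> real \<Rightarrow> (real \<Rightarrow> 'a set) \<Rightarrow> bool" where
  "is_path \<equiv> lagrangian_path \<omega>"

lemma path_subinterval:
  assumes "is_path a b l" "a \<le> c" "c \<le> d" "d \<le> b"
  shows "is_path c d l"
proof -
  have "{c..d} \<subseteq> {a..b}" using assms by auto
  moreover from this have "continuous_map (top_of_set {c..d}) (lagrangian_topology \<omega>) l"
    using assms(1) unfolding lagrangian_path_def by (meson continuous_map_from_subtopology_mono)
  ultimately show ?thesis using assms unfolding lagrangian_path_def by blast
qed

lemma path_le: "is_path a b l \<Longrightarrow> a \<le> b"
  by (simp add: lagrangian_path_def)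

lemma path_lagrangian: "is_path a b l \<Longrightarrow> t \<in> {a..b} \<Longrightarrow> l t \<in> lagrangians \<omega>"
  by (auto simp: lagrangian_path_def)

lemma path_nbhd:
  assumes "is_path a b l" "openin (lagrangian_topology \<omega>) \<U>" "t \<in> {a..b}" "l t \<in> \<U>"
  obtains \<delta> where "\<delta> > 0" "\<And>s. s \<in> {a..b} \<Longrightarrow> \<bar>s - t\<bar> < \<delta> \<Longrightarrow> l s \<in> \<U>"
proof -
  have "continuous_map (top_of_set {a..b}) (lagrangian_topology \<omega>) l"
    using assms(1) by (simp add: lagrangian_path_def)
  then obtain \<delta> where "\<delta> > 0" "\<And>s. s \<in> {a..b} \<Longrightarrow> dist s t < \<delta> \<Longrightarrow> l s \<in> \<U>"
    by (rule continuous_map_top_of_set_nbhd[where f = l, OF _ assms(2,3,4)]) (rule that; assumption)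
  then show ?thesis by (intro that[of \<delta>]) (simp_all add: dist_real_def)
qed

lemma path_compl_nbhd:
  assumes "is_path a b l" "t \<in> {a..b}" "compl M (l t)"
  obtains \<delta> where "\<delta> > 0" "\<And>s. s \<in> {a..b} \<Longrightarrow> \<bar>s - t\<bar> < \<delta> \<Longrightarrow> compl M (l s)"
proof -
  have "M \<in> lagrangians \<omega>" using assms(3) by (simp add: compl_def)
  then have "openin (lagrangian_topology \<omega>) {L. compl M L}" by (rule openin_compl)
  moreover have "l t \<in> {L. compl M L}" using assms(3) by simp
  ultimately obtain \<delta> where "\<delta> > 0" "\<And>s. s \<in> {a..b} \<Longrightarrow> \<bar>s - t\<bar> < \<delta> \<Longrightarrow> l s \<in> {L. compl M L}"
    by (rule path_nbhd[OF assms(1) _ assms(2)]) (rule that; assumption)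
  then show ?thesis by (intro that[of \<delta>]) simp_all
qed

lemma path_change_nbhd:
  assumes "is_path a b l" "t \<in> {a..b}"
    and c: "compl M X" "compl N X" "compl M (l t)" "compl N (l t)"
  obtains \<delta> where "\<delta> > 0"
    "\<And>s. s \<in> {a..b} \<Longrightarrow> \<bar>s - t\<bar> < \<delta> \<Longrightarrow> compl M (l s) \<and> compl N (l s) \<and>
       rel_index M X (l s) - rel_index N X (l s) = rel_index M X (l t) - rel_index N X (l t)"
proof -
  obtain \<U> where U: "openin (lagrangian_topology \<omega>) \<U>" "l t \<in> \<U>"
    "\<And>L. L \<in> \<U> \<Longrightarrow> compl M L \<and> compl N L \<and>
       rel_index M X L - rel_index N X L = rel_index M X (l t) - rel_index N X (l t)"
    by (rule rel_index_change_locally_constant[OF c]) (rule that; assumption)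
  obtain \<delta> where "\<delta> > 0" "\<And>s. s \<in> {a..b} \<Longrightarrow> \<bar>s - t\<bar> < \<delta> \<Longrightarrow> l s \<in> \<U>"
    by (rule path_nbhd[OF assms(1) U(1) assms(2) U(2)]) (rule that; assumption)
  then show ?thesis using U(3) by (intro that[of \<delta>]) simp_all
qed

text \<open>An integer function along a path that differs, near each time \<open>t\<close>, by a constant from the coindex
  in any chart of Lagrangians transverse to \<open>M\<close>, for \<open>M\<close> transverse to \<open>X\<close> and \<open>l t\<close>. Its total
  increment is the Maslov index. Demanding this for every admissible \<open>M\<close> rather than for one makes
  primitives easy to glue and compare; by \<open>primitive_rel_index\<close> it
  is enough to check one \<open>M\<close> on an interval that \<open>l\<close> maps into one chart.\<close>
definition primitive :: "'a set \<Rightarrow> real \<Rightarrow> real \<Rightarrow> (real \<Rightarrow> 'a set) \<Rightarrow> (real \<Rightarrow> int) \<Rightarrow> bool" where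
  "primitive X a b l K \<longleftrightarrow> (\<forall>t\<in>{a..b}. \<forall>M. compl M X \<longrightarrow> compl M (l t) \<longrightarrow>
     (\<exists>\<delta>>0. \<forall>s\<in>{a..b}. \<bar>s - t\<bar> < \<delta> \<longrightarrow>
        K s - rel_index M X (l s) = K t - rel_index M X (l t)))"

lemma primitiveD:
  assumes "primitive X a b l K" "t \<in> {a..b}" "compl M X" "compl M (l t)"
  obtains \<delta> where "\<delta> > 0" "\<And>s. s \<in> {a..b} \<Longrightarrow> \<bar>s - t\<bar> < \<delta> \<Longrightarrow>
        K s - rel_index M X (l s) = K t - rel_index M X (l t)"
proof -
  have "\<exists>\<delta>>0. \<forall>s\<in>{a..b}. \<bar>s - t\<bar> < \<delta> \<longrightarrow> K s - rel_index M X (l s) = K t - rel_index M X (l t)"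
    using assms unfolding primitive_def by simp
  then obtain \<delta> where "\<delta> > 0" "\<forall>s\<in>{a..b}. \<bar>s - t\<bar> < \<delta> \<longrightarrow>
      K s - rel_index M X (l s) = K t - rel_index M X (l t)" by blast
  then show ?thesis by (intro that[of \<delta>]) simp_all
qed

lemma primitive_rel_index:
  assumes p: "is_path a b l" and M: "compl M X" "\<And>t. t \<in> {a..b} \<Longrightarrow> compl M (l t)"
  shows "primitive X a b l (\<lambda>s. rel_index M X (l s))"
  unfolding primitive_def
proof (intro ballI allI impI)
  fix t N assume t: "t \<in> {a..b}" and N: "compl N X" "compl N (l t)"
  obtain \<delta> where d: "\<delta> > 0"
    "\<And>s. s \<in> {a..b} \<Longrightarrow> \<bar>s - t\<bar> < \<delta> \<Longrightarrow> compl M (l s) \<and> compl N (l s) \<and>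
       rel_index M X (l s) - rel_index N X (l s) = rel_index M X (l t) - rel_index N X (l t)"
    by (rule path_change_nbhd[OF p t M(1) N(1) M(2)[OF t] N(2)]) (rule that; assumption)
  show "\<exists>\<delta>>0. \<forall>s\<in>{a..b}. \<bar>s - t\<bar> < \<delta> \<longrightarrow>
     rel_index M X (l s) - rel_index N X (l s) = rel_index M X (l t) - rel_index N X (l t)"
    using d by (intro exI[of _ \<delta>]) simp
qed

lemma primitive_subinterval:
  assumes "primitive X a b l K" "a \<le> c" "d \<le> b"
  shows "primitive X c d l K"
  unfolding primitive_def
proof (intro ballI allI impI)
  fix t M assume t: "t \<in> {c..d}" and M: "compl M X" "compl M (l t)"
  have t': "t \<in> {a..b}" using t assms by simp
  obtain \<delta> where "\<delta> > 0" "\<And>s. s \<in> {a..b} \<Longrightarrow> \<bar>s - t\<bar> < \<delta> \<Longrightarrow>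
        K s - rel_index M X (l s) = K t - rel_index M X (l t)"
    by (rule primitiveD[OF assms(1) t' M]) (rule that; assumption)
  then show "\<exists>\<delta>>0. \<forall>s\<in>{c..d}. \<bar>s - t\<bar> < \<delta> \<longrightarrow> K s - rel_index M X (l s) = K t - rel_index M X (l t)"
    using assms(2,3) by (intro exI[of _ \<delta>]) simp
qed

lemma primitive_glue:
  assumes K: "primitive X p q l K" and H: "primitive X q r l H" and "p \<le> q" "q \<le> r"
  shows "primitive X p r l (\<lambda>s. if s \<le> q then K s else H s + (K q - H q))" (is "primitive X p r l ?G")
  unfolding primitive_def
proof (intro ballI allI impI)
  fix t M assume t: "t \<in> {p..r}" and M: "compl M X" "compl M (l t)"
  have G2: "?G s = H s + (K q - H q)" if "q \<le> s" for s using that by auto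
  consider "t < q" | "t = q" | "q < t" by linarith
  then show "\<exists>\<delta>>0. \<forall>s\<in>{p..r}. \<bar>s - t\<bar> < \<delta> \<longrightarrow> ?G s - rel_index M X (l s) = ?G t - rel_index M X (l t)"
  proof cases
    case 1
    then have "t \<in> {p..q}" using t by simp
    then obtain \<delta> where d: "\<delta> > 0" "\<And>s. s \<in> {p..q} \<Longrightarrow> \<bar>s - t\<bar> < \<delta> \<Longrightarrow>
        K s - rel_index M X (l s) = K t - rel_index M X (l t)"
      by (rule primitiveD[OF K _ M]) (rule that; assumption)
    then show ?thesis using 1 by (intro exI[of _ "min \<delta> (q - t)"]) auto
  next
    case 2
    have "q \<in> {p..q}" "q \<in> {q..r}" using assms(3,4) by auto
    then obtain \<delta> \<epsilon> where d: "\<delta> > 0" "\<And>s. s \<in> {p..q} \<Longrightarrow> \<bar>s - t\<bar> < \<delta> \<Longrightarrow>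
        K s - rel_index M X (l s) = K t - rel_index M X (l t)"
      and e: "\<epsilon> > 0" "\<And>s. s \<in> {q..r} \<Longrightarrow> \<bar>s - t\<bar> < \<epsilon> \<Longrightarrow>
        H s - rel_index M X (l s) = H t - rel_index M X (l t)"
      using primitiveD[OF K _ M] primitiveD[OF H _ M] 2 by metis
    show ?thesis
    proof (intro exI[of _ "min \<delta> \<epsilon>"] conjI ballI impI)
      fix s assume s: "s \<in> {p..r}" "\<bar>s - t\<bar> < min \<delta> \<epsilon>"
      show "?G s - rel_index M X (l s) = ?G t - rel_index M X (l t)"
      proof (cases "s \<le> q")
        case True then show ?thesis using d(2)[of s] s 2 by simp
      next
        case False then show ?thesis using e(2)[of s] s 2 by simp
      qed
    qed (use d e in simp)
  next
    case 3
    then have "t \<in> {q..r}" using t by simp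
    then obtain \<delta> where d: "\<delta> > 0" "\<And>s. s \<in> {q..r} \<Longrightarrow> \<bar>s - t\<bar> < \<delta> \<Longrightarrow>
        H s - rel_index M X (l s) = H t - rel_index M X (l t)"
      by (rule primitiveD[OF H _ M]) (rule that; assumption)
    show ?thesis
    proof (intro exI[of _ "min \<delta> (t - q)"] conjI ballI impI)
      fix s assume s: "s \<in> {p..r}" "\<bar>s - t\<bar> < min \<delta> (t - q)"
      then have "s \<in> {q..r}" by auto
      then show "?G s - rel_index M X (l s) = ?G t - rel_index M X (l t)"
        using d(2)[of s] s 3 by auto
    qed (use d 3 in simp)
  qed
qed

lemma path_common_complement:
  assumes "X \<in> lagrangians \<omega>" "is_path a b l" "t \<in> {a..b}"
  obtains M where "compl M X" "compl M (l t)"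
  by (rule common_complement[of "{X, l t}"]) (use assms path_lagrangian in auto)

lemma primitive_exists:
  assumes X: "X \<in> lagrangians \<omega>" and p: "is_path a b l"
  shows "\<exists>K. primitive X a b l K"
  using path_le[OF p]
proof (induction rule: subinterval_induct)
  case (trans p q r)
  then show ?case using primitive_glue[of X p q l _ r] by blast
next
  case (local t)
  then have t: "t \<in> {a..b}" by simp
  obtain M where M: "compl M X" "compl M (l t)" by (rule path_common_complement[OF X p t])
  obtain \<delta> where d: "\<delta> > 0" "\<And>s. s \<in> {a..b} \<Longrightarrow> \<bar>s - t\<bar> < \<delta> \<Longrightarrow> compl M (l s)"
    by (rule path_compl_nbhd[OF p t M(2)]) (rule that; assumption)
  show ?case
  proof (intro exI[of _ \<delta>] conjI allI impI d(1))
    fix c d assume cd: "a \<le> c \<and> c \<le> t \<and> t \<le> d \<and> d \<le> b \<and> d - c < \<delta>"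
    have "is_path c d l" using cd by (intro path_subinterval[OF p]) auto
    then have "primitive X c d l (\<lambda>s. rel_index M X (l s))"
      by (rule primitive_rel_index[OF _ M(1)]) (use d(2) cd in auto)
    then show "\<exists>K. primitive X c d l K" by blast
  qed
qed

lemma primitive_increment_unique:
  assumes X: "X \<in> lagrangians \<omega>" and p: "is_path a b l"
    and K: "primitive X a b l K" and H: "primitive X a b l H"
  shows "K b - K a = H b - H a"
  using path_le[OF p]
proof (induction rule: subinterval_induct)
  case (trans p q r)
  then show ?case by linarith
next
  case (local t)
  then have t: "t \<in> {a..b}" by simp
  obtain M where M: "compl M X" "compl M (l t)" by (rule path_common_complement[OF X p t])
  obtain \<delta> where d: "\<delta> > 0" "\<And>s. s \<in> {a..b} \<Longrightarrow> \<bar>s - t\<bar> < \<delta> \<Longrightarrow>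
      K s - rel_index M X (l s) = K t - rel_index M X (l t)" by (rule primitiveD[OF K t M]) (rule that; assumption)
  obtain \<epsilon> where e: "\<epsilon> > 0" "\<And>s. s \<in> {a..b} \<Longrightarrow> \<bar>s - t\<bar> < \<epsilon> \<Longrightarrow>
      H s - rel_index M X (l s) = H t - rel_index M X (l t)" by (rule primitiveD[OF H t M]) (rule that; assumption)
  show ?case
  proof (intro exI[of _ "min \<delta> \<epsilon>"] conjI allI impI)
    fix c d' assume cd: "a \<le> c \<and> c \<le> t \<and> t \<le> d' \<and> d' \<le> b \<and> d' - c < min \<delta> \<epsilon>"
    show "K d' - K c = H d' - H c"
      using d(2)[of c] d(2)[of d'] e(2)[of c] e(2)[of d'] cd by simp
  qed (use d e in simp)
qed

text \<open>The increment of any primitive; meaningful on continuous Lagrangian paths, where a primitive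
  exists and its increment is unique.\<close>
definition path_index :: "'a set \<Rightarrow> real \<Rightarrow> real \<Rightarrow> (real \<Rightarrow> 'a set) \<Rightarrow> int" where
  "path_index X a b l = (THE k. \<exists>K. primitive X a b l K \<and> k = K b - K a)"

lemma path_index_eq:
  assumes "X \<in> lagrangians \<omega>" "is_path a b l" "primitive X a b l K"
  shows "path_index X a b l = K b - K a"
  unfolding path_index_def
proof (rule the_equality)
  show "\<exists>H. primitive X a b l H \<and> K b - K a = H b - H a" using assms(3) by blast
  fix k assume "\<exists>H. primitive X a b l H \<and> k = H b - H a"
  then obtain H where H: "primitive X a b l H" "k = H b - H a" by blast
  show "k = K b - K a"
    unfolding H(2) by (rule primitive_increment_unique[OF assms(1,2) H(1) assms(3)])
qed

lemma path_index_add: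
  assumes X: "X \<in> lagrangians \<omega>" and p: "is_path a b l" and c: "c \<in> {a..b}"
  shows "path_index X a b l = path_index X a c l + path_index X c b l"
proof -
  obtain K where K: "primitive X a b l K" using primitive_exists[OF X p] by blast
  have "is_path a c l" "is_path c b l" using c by (auto intro: path_subinterval[OF p])
  moreover have "primitive X a c l K" "primitive X c b l K"
    using c by (auto intro: primitive_subinterval[OF K])
  ultimately show ?thesis using path_index_eq[OF X] p K by simp
qed

lemma path_index_chart:
  assumes "is_path a b l" "compl M X" "\<And>t. t \<in> {a..b} \<Longrightarrow> compl M (l t)"
  shows "path_index X a b l = rel_index M X (l b) - rel_index M X (l a)"
proof -
  have "X \<in> lagrangians \<omega>" using assms(2) by (simp add: compl_def)
  then show ?thesis using path_index_eq[OF _ assms(1) primitive_rel_index[OF assms]] by simp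
qed

text \<open>The index of the curves \<open>F s\<close> is, up to corrections depending only on the end points, locally
  constant in \<open>s\<close>. The corrected quantity is additive under subdivision, which reduces the claim to
  short intervals, where the whole strip near \<open>s0\<close> lies in one chart.\<close>
lemma path_index_locally_constant:
  fixes F :: "real \<Rightarrow> real \<Rightarrow> 'a set"
  assumes X: "X \<in> lagrangians \<omega>" and ab: "a \<le> b"
    and F: "continuous_map (top_of_set ({0..1} \<times> {a..b})) (lagrangian_topology \<omega>) (\<lambda>(s,t). F s t)"
    and rows: "\<And>s. s \<in> {0..1} \<Longrightarrow> is_path a b (F s)"
    and cols: "\<And>t. t \<in> {a..b} \<Longrightarrow> is_path 0 1 (\<lambda>s. F s t)"
    and s0: "s0 \<in> {0..1}"
    and MN: "compl M X" "compl M (F s0 a)" "compl N X" "compl N (F s0 b)"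
  shows "\<exists>\<epsilon>>0. \<forall>s\<in>{0..1}. \<bar>s - s0\<bar> < \<epsilon> \<longrightarrow>
     path_index X a b (F s) - rel_index N X (F s b) + rel_index M X (F s a) =
     path_index X a b (F s0) - rel_index N X (F s0 b) + rel_index M X (F s0 a)"
proof -
  define W where "W c d M N s = path_index X c d (F s) - rel_index N X (F s d) + rel_index M X (F s c)"
    for c d M N s
  define P where "P c d \<longleftrightarrow> (\<forall>M N. compl M X \<longrightarrow> compl M (F s0 c) \<longrightarrow> compl N X \<longrightarrow> compl N (F s0 d) \<longrightarrow>
    (\<exists>\<epsilon>>0. \<forall>s\<in>{0..1}. \<bar>s - s0\<bar> < \<epsilon> \<longrightarrow> W c d M N s = W c d M N s0))" for c d
  have "P a b" using ab
  proof (induction rule: subinterval_induct)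
    case (trans p q r)
    have q: "q \<in> {a..b}" using trans by simp
    show ?case unfolding P_def
    proof (intro allI impI)
      fix M N assume M: "compl M X" "compl M (F s0 p)" and N: "compl N X" "compl N (F s0 r)"
      obtain J where J: "compl J X" "compl J (F s0 q)"
        by (rule path_common_complement[OF X rows[OF s0] q])
      obtain \<delta> where d: "\<delta> > 0" "\<forall>s\<in>{0..1}. \<bar>s - s0\<bar> < \<delta> \<longrightarrow> W p q M J s = W p q M J s0"
        using trans(5) M J unfolding P_def by blast
      obtain \<epsilon> where e: "\<epsilon> > 0" "\<forall>s\<in>{0..1}. \<bar>s - s0\<bar> < \<epsilon> \<longrightarrow> W q r J N s = W q r J N s0"
        using trans(6) J N unfolding P_def by blast
      have add: "W p r M N s = W p q M J s + W q r J N s" if s: "s \<in> {0..1}" for s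
      proof -
        have "is_path p r (F s)" using trans by (intro path_subinterval[OF rows[OF s]]) auto
        then have "path_index X p r (F s) = path_index X p q (F s) + path_index X q r (F s)"
          using trans(2,3) by (intro path_index_add[OF X]) auto
        then show ?thesis by (simp add: W_def)
      qed
      have "\<forall>s\<in>{0..1}. \<bar>s - s0\<bar> < min \<delta> \<epsilon> \<longrightarrow> W p r M N s = W p r M N s0"
        using d(2) e(2) add s0 by simp
      then show "\<exists>\<epsilon>>0. \<forall>s\<in>{0..1}. \<bar>s - s0\<bar> < \<epsilon> \<longrightarrow> W p r M N s = W p r M N s0"
        using d(1) e(1) by (intro exI[of _ "min \<delta> \<epsilon>"]) simp
    qed
  next
    case (local t)
    then have t: "t \<in> {a..b}" by simp
    obtain J where J: "compl J X" "compl J (F s0 t)"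
      by (rule path_common_complement[OF X rows[OF s0] t])
    have "J \<in> lagrangians \<omega>" using J by (simp add: compl_def)
    then have "openin (lagrangian_topology \<omega>) {L. compl J L}" by (rule openin_compl)
    then obtain \<delta> where d: "\<delta> > 0" "\<And>y. y \<in> {0..1} \<times> {a..b} \<Longrightarrow> dist y (s0, t) < \<delta> \<Longrightarrow>
        (\<lambda>(s,t). F s t) y \<in> {L. compl J L}"
      by (rule continuous_map_top_of_set_nbhd[OF F, where x = "(s0, t)"]) (use s0 t J in auto)
    have J': "compl J (F s t')" if "s \<in> {0..1}" "t' \<in> {a..b}" "\<bar>s - s0\<bar> < \<delta> / 2" "\<bar>t' - t\<bar> < \<delta> / 2" for s t'
    proof -
      have "dist (s, t') (s0, t) \<le> \<bar>s - s0\<bar> + \<bar>t' - t\<bar>"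
        by (simp add: dist_Pair_Pair dist_real_def sqrt_sum_squares_le_sum_abs[of "\<bar>s - s0\<bar>" "\<bar>t' - t\<bar>", simplified])
      then have "dist (s, t') (s0, t) < \<delta>" using that(3,4) by linarith
      then show ?thesis using d(2)[of "(s, t')"] that by simp
    qed
    show ?case
    proof (intro exI[of _ "\<delta> / 2"] conjI allI impI)
      fix c e assume ce: "a \<le> c \<and> c \<le> t \<and> t \<le> e \<and> e \<le> b \<and> e - c < \<delta> / 2"
      then have c: "c \<in> {a..b}" and e: "e \<in> {a..b}" by auto
      show "P c e" unfolding P_def
      proof (intro allI impI)
        fix M N assume M: "compl M X" "compl M (F s0 c)" and N: "compl N X" "compl N (F s0 e)"
        have Jc: "compl J (F s0 c)" and Je: "compl J (F s0 e)" using J'[OF s0 c] J'[OF s0 e] ce d(1) by auto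
        obtain \<delta>1 where d1: "\<delta>1 > 0" "\<And>s. s \<in> {0..1} \<Longrightarrow> \<bar>s - s0\<bar> < \<delta>1 \<Longrightarrow>
          compl J (F s c) \<and> compl M (F s c) \<and>
          rel_index J X (F s c) - rel_index M X (F s c) = rel_index J X (F s0 c) - rel_index M X (F s0 c)"
          by (rule path_change_nbhd[OF cols[OF c] s0 J(1) M(1) Jc M(2)]) (rule that; assumption)
        obtain \<delta>2 where d2: "\<delta>2 > 0" "\<And>s. s \<in> {0..1} \<Longrightarrow> \<bar>s - s0\<bar> < \<delta>2 \<Longrightarrow>
          compl J (F s e) \<and> compl N (F s e) \<and>
          rel_index J X (F s e) - rel_index N X (F s e) = rel_index J X (F s0 e) - rel_index N X (F s0 e)"
          by (rule path_change_nbhd[OF cols[OF e] s0 J(1) N(1) Je N(2)]) (rule that; assumption)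
        have ch: "path_index X c e (F s) = rel_index J X (F s e) - rel_index J X (F s c)"
          if s: "s \<in> {0..1}" "\<bar>s - s0\<bar> < \<delta> / 2" for s
        proof (rule path_index_chart[OF _ J(1)])
          show "is_path c e (F s)" using ce by (intro path_subinterval[OF rows[OF s(1)]]) auto
          fix t' assume "t' \<in> {c..e}"
          then have "t' \<in> {a..b}" "\<bar>t' - t\<bar> \<le> e - c" using ce by auto
          then show "compl J (F s t')" using ce s by (intro J') auto
        qed
        show "\<exists>\<epsilon>>0. \<forall>s\<in>{0..1}. \<bar>s - s0\<bar> < \<epsilon> \<longrightarrow> W c e M N s = W c e M N s0"
        proof (intro exI[of _ "min (\<delta> / 2) (min \<delta>1 \<delta>2)"] conjI ballI impI)
          fix s :: real assume s: "s \<in> {0..1}" "\<bar>s - s0\<bar> < min (\<delta> / 2) (min \<delta>1 \<delta>2)"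
          have s': "\<bar>s - s0\<bar> < \<delta> / 2" "\<bar>s - s0\<bar> < \<delta>1" "\<bar>s - s0\<bar> < \<delta>2" "\<bar>s0 - s0\<bar> < \<delta> / 2"
            using s(2) d(1) by auto
          show "W c e M N s = W c e M N s0"
            using ch[OF s(1) s'(1)] ch[OF s0 s'(4)] d1(2)[OF s(1) s'(2)] d2(2)[OF s(1) s'(3)]
            by (simp add: W_def)
        qed (use d(1) d1(1) d2(1) in simp)
      qed
    qed (use d(1) in simp)
  qed
  then show ?thesis using MN unfolding P_def W_def by blast
qed

lemma path_index_homotopic:
  assumes X: "X \<in> lagrangians \<omega>" and p: "is_path a b l" and p': "is_path a b l'"
    and hom: "homotopic_with (\<lambda>h. h a = l a \<and> h b = l b) (top_of_set {a..b}) (lagrangian_topology \<omega>) l l'"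
  shows "path_index X a b l = path_index X a b l'"
proof -
  obtain h where h: "continuous_map (prod_topology (top_of_set {0..1::real}) (top_of_set {a..b})) (lagrangian_topology \<omega>) h"
    and h0: "\<And>x. h (0, x) = l x" and h1: "\<And>x. h (1, x) = l' x"
    and ends: "\<And>s. s \<in> {0..1} \<Longrightarrow> h (s, a) = l a \<and> h (s, b) = l b"
    using hom unfolding homotopic_with_def by auto
  define F where "F s t = h (s, t)" for s t
  have hF: "(\<lambda>(s,t). F s t) = h" by (auto simp: F_def)
  have ab: "a \<le> b" using path_le[OF p] .
  have top: "prod_topology (top_of_set {0..1::real}) (top_of_set {a..b}) = top_of_set ({0..1} \<times> {a..b})"
    by (metis euclidean_product_topology prod_topology_euclidean subtopology_Times)
  have into: "h y \<in> lagrangians \<omega>" if "y \<in> {0..1} \<times> {a..b}" for y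
    using continuous_map_image_subset_topspace[OF h] that topspace_lagrangian_topology by fastforce
  have rows: "is_path a b (F s)" if s: "s \<in> {0..1}" for s
  proof -
    have "continuous_map (top_of_set {a..b}) (prod_topology (top_of_set {0..1::real}) (top_of_set {a..b})) (\<lambda>t. (s, t))"
      using s by (intro continuous_map_pairedI) auto
    from continuous_map_compose[OF this h] show ?thesis
      using ab s into by (auto simp: lagrangian_path_def F_def[abs_def] o_def)
  qed
  have cols: "is_path 0 1 (\<lambda>s. F s t)" if t: "t \<in> {a..b}" for t
  proof -
    have "continuous_map (top_of_set {0..1::real}) (prod_topology (top_of_set {0..1::real}) (top_of_set {a..b})) (\<lambda>s. (s, t))"
      using t by (intro continuous_map_pairedI) auto
    from continuous_map_compose[OF this h] show ?thesis
      using t into by (auto simp: lagrangian_path_def F_def[abs_def] o_def)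
  qed
  have F: "continuous_map (top_of_set ({0..1} \<times> {a..b})) (lagrangian_topology \<omega>) (\<lambda>(s,t). F s t)"
    using h unfolding hF top .
  have Fa: "F s a = l a" "F s b = l b" if "s \<in> {0..1}" for s using ends[OF that] by (auto simp: F_def)
  have "path_index X a b (F 0) = path_index X a b (F 1)"
  proof (induction rule: subinterval_induct[OF zero_le_one])
    case (1 p q r) then show ?case by simp
  next
    case (2 s)
    then have s: "s \<in> {0..1}" by simp
    obtain M where M: "compl M X" "compl M (F s a)"
      by (rule path_common_complement[OF X rows[OF s], of a]) (use ab in auto)
    obtain N where N: "compl N X" "compl N (F s b)"
      by (rule path_common_complement[OF X rows[OF s], of b]) (use ab in auto)
    obtain \<epsilon> where e: "\<epsilon> > 0" "\<And>s'. s' \<in> {0..1} \<Longrightarrow> \<bar>s' - s\<bar> < \<epsilon> \<Longrightarrow>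
     path_index X a b (F s') - rel_index N X (F s' b) + rel_index M X (F s' a) =
     path_index X a b (F s) - rel_index N X (F s b) + rel_index M X (F s a)"
      using path_index_locally_constant[OF X ab F rows cols s M N] by blast
    show ?case
    proof (intro exI[of _ \<epsilon>] conjI allI impI e(1))
      fix c d assume cd: "0 \<le> c \<and> c \<le> s \<and> s \<le> d \<and> d \<le> 1 \<and> d - c < \<epsilon>"
      then have "c \<in> {0..1}" "d \<in> {0..1}" "\<bar>c - s\<bar> < \<epsilon>" "\<bar>d - s\<bar> < \<epsilon>" by auto
      then show "path_index X a b (F c) = path_index X a b (F d)"
        using e(2)[of c] e(2)[of d] Fa[of c] Fa[of d] Fa[OF s] by simp
    qed
  qed
  then show ?thesis by (simp add: F_def[abs_def] h0 h1)
qed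

lemma is_maslov_index_path_index:
  assumes X: "X \<in> lagrangians \<omega>"
  shows "is_maslov_index \<omega> X (path_index X)"
  unfolding is_maslov_index_def
proof (intro conjI allI impI)
  fix a b l l' assume "is_path a b l \<and> is_path a b l' \<and>
    homotopic_with (\<lambda>h. h a = l a \<and> h b = l b) (top_of_set {a..b}) (lagrangian_topology \<omega>) l l'"
  then show "path_index X a b l = path_index X a b l'" using path_index_homotopic[OF X] by blast
next
  fix a b c l assume "is_path a b l \<and> c \<in> {a..b}"
  then show "path_index X a b l = path_index X a c l + path_index X c b l"
    using path_index_add[OF X] by blast
next
  fix a b l M assume *: "is_path a b l \<and> M \<in> lagrangians \<omega> \<and> transverse X M \<and>
      l ` {a..b} \<subseteq> transverse_lagrangians \<omega> M"
  then have MX: "compl M X" using X by (auto simp: compl_def transverse_def)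
  have Ml: "compl M (l t)" if "t \<in> {a..b}" for t using * that transverse_lagrangians_eq by blast
  have "a \<le> b" using * path_le by blast
  then show "path_index X a b l = int (pos_index X (chart \<omega> X M (l b))) - int (pos_index X (chart \<omega> X M (l a)))"
    using path_index_chart[OF _ MX Ml] * by (simp add: pos_index_chart[OF MX Ml])
qed

lemma maslov_index_eq_path_index:
  assumes X: "X \<in> lagrangians \<omega>" and p: "is_path a b l"
  shows "maslov_index \<omega> X a b l = path_index X a b l"
  unfolding maslov_index_def
proof (rule the_equality)
  show "\<exists>\<mu>. is_maslov_index \<omega> X \<mu> \<and> \<mu> a b l = path_index X a b l"
    using is_maslov_index_path_index[OF X] by blast
next
  fix k assume "\<exists>\<mu>. is_maslov_index \<omega> X \<mu> \<and> \<mu> a b l = k"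
  then obtain \<mu> where mu: "is_maslov_index \<omega> X \<mu>" "k = \<mu> a b l" by blast
  have add: "\<mu> p r l = \<mu> p q l + \<mu> q r l" if "is_path p r l" "q \<in> {p..r}" for p q r
    using mu(1) that unfolding is_maslov_index_def by blast
  have ch: "\<mu> c d l = path_index X c d l"
    if cd: "is_path c d l" and M: "compl M X" "\<And>t. t \<in> {c..d} \<Longrightarrow> compl M (l t)" for c d M
  proof -
    have L: "M \<in> lagrangians \<omega>" and T: "transverse X M" using M(1) by (auto simp: compl_def transverse_def)
    have "l ` {c..d} \<subseteq> transverse_lagrangians \<omega> M" using M(2) transverse_lagrangians_eq[OF L] by auto
    then have "is_path c d l \<and> M \<in> lagrangians \<omega> \<and> transverse X M \<and> l ` {c..d} \<subseteq> transverse_lagrangians \<omega> M"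
      using cd L T by simp
    then have eq: "\<nu> c d l = int (pos_index X (chart \<omega> X M (l d))) - int (pos_index X (chart \<omega> X M (l c)))"
      if "is_maslov_index \<omega> X \<nu>" for \<nu>
      using that unfolding is_maslov_index_def by blast
    show ?thesis using eq[OF mu(1)] eq[OF is_maslov_index_path_index[OF X]] by simp
  qed
  have "\<mu> a b l = path_index X a b l"
    using path_le[OF p]
  proof (induction rule: subinterval_induct)
    case (trans q r s)
    have "is_path q s l" using trans by (intro path_subinterval[OF p]) auto
    then show ?case using add[of q s r] path_index_add[OF X, of q s l r] trans by simp
  next
    case (local t)
    then have t: "t \<in> {a..b}" by simp
    obtain M where M: "compl M X" "compl M (l t)" by (rule path_common_complement[OF X p t])
    obtain \<delta> where d: "\<delta> > 0" "\<And>s. s \<in> {a..b} \<Longrightarrow> \<bar>s - t\<bar> < \<delta> \<Longrightarrow> compl M (l s)"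
      by (rule path_compl_nbhd[OF p t M(2)]) (rule that; assumption)
    show ?case
    proof (intro exI[of _ \<delta>] conjI allI impI d(1))
      fix c e assume ce: "a \<le> c \<and> c \<le> t \<and> t \<le> e \<and> e \<le> b \<and> e - c < \<delta>"
      show "\<mu> c e l = path_index X c e l"
      proof (rule ch[OF _ M(1)])
        show "is_path c e l" using ce by (intro path_subinterval[OF p]) auto
        fix s assume "s \<in> {c..e}" then show "compl M (l s)" using ce by (intro d(2)) auto
      qed
    qed
  qed
  then show "k = path_index X a b l" using mu(2) by simp
qed

section \<open>Comparison of two Maslov indices\<close>

text \<open>On a short interval a single \<open>N\<close> transverse to \<open>X\<close>, \<open>X'\<close> and the path serves both indices. Since
  the Hoermander index does not depend on \<open>N\<close>, these local formulas add up to one in the end points.\<close>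
lemma path_index_diff:
  assumes X: "X \<in> lagrangians \<omega>" and X': "X' \<in> lagrangians \<omega>" and p: "is_path a b l"
    and M: "\<And>L. L \<in> {X, X', l a, l b} \<Longrightarrow> compl M L"
  shows "path_index X a b l - path_index X' a b l = hormander_index M X X' (l a) (l b)"
proof -
  define P where "P c d \<longleftrightarrow> (\<forall>M. (\<forall>L\<in>{X, X', l c, l d}. compl M L) \<longrightarrow>
    path_index X c d l - path_index X' c d l = hormander_index M X X' (l c) (l d))" for c d
  have lag: "l t \<in> lagrangians \<omega>" if "a \<le> t" "t \<le> b" for t
    using path_lagrangian[OF p] that by simp
  have "P a b" using path_le[OF p]
  proof (induction rule: subinterval_induct)
    case (trans q r s)
    show ?case unfolding P_def
    proof (intro allI impI)
      fix M assume M: "\<forall>L\<in>{X, X', l q, l s}. compl M L"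
      have lags: "{X, X', l q, l r, l s} \<subseteq> lagrangians \<omega>" using X X' lag trans by auto
      obtain N where N: "\<And>L. L \<in> {X, X', l q, l r, l s} \<Longrightarrow> compl N L"
        by (rule common_complement[OF _ lags]) auto
      have pq: "is_path q s l" using trans by (intro path_subinterval[OF p]) auto
      have "\<forall>L\<in>{X, X', l q, l r}. compl N L" "\<forall>L\<in>{X, X', l r, l s}. compl N L"
        using N by auto
      then have "path_index X q r l - path_index X' q r l = hormander_index N X X' (l q) (l r)"
        "path_index X r s l - path_index X' r s l = hormander_index N X X' (l r) (l s)"
        using trans(5,6) unfolding P_def by blast+
      then have "path_index X q s l - path_index X' q s l
        = hormander_index N X X' (l q) (l r) + hormander_index N X X' (l r) (l s)"
        using path_index_add[OF X pq, of r] path_index_add[OF X' pq, of r] trans(2,3) by simp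
      also have "\<dots> = hormander_index N X X' (l q) (l s)" by (simp add: hormander_index_def)
      also have "\<dots> = hormander_index M X X' (l q) (l s)" by (rule hormander_index_indep) (use N M in auto)
      finally show "path_index X q s l - path_index X' q s l = hormander_index M X X' (l q) (l s)" .
    qed
  next
    case (local t)
    then have t: "t \<in> {a..b}" by simp
    have lags: "{X, X', l t} \<subseteq> lagrangians \<omega>" using X X' lag local by auto
    obtain N where N: "\<And>L. L \<in> {X, X', l t} \<Longrightarrow> compl N L"
      by (rule common_complement[OF _ lags]) auto
    have Nt: "compl N (l t)" by (rule N) simp
    obtain \<delta> where d: "\<delta> > 0" "\<And>s. s \<in> {a..b} \<Longrightarrow> \<bar>s - t\<bar> < \<delta> \<Longrightarrow> compl N (l s)"
      by (rule path_compl_nbhd[OF p t Nt]) (rule that; assumption)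
    show ?case
    proof (intro exI[of _ \<delta>] conjI allI impI d(1))
      fix c e assume ce: "a \<le> c \<and> c \<le> t \<and> t \<le> e \<and> e \<le> b \<and> e - c < \<delta>"
      have pc: "is_path c e l" using ce by (intro path_subinterval[OF p]) auto
      have Nc: "compl N (l s)" if "s \<in> {c..e}" for s using that ce by (intro d(2)) auto
      have "path_index X c e l - path_index X' c e l = hormander_index N X X' (l c) (l e)"
        unfolding hormander_index_def
        using path_index_chart[OF pc N[of X] Nc] path_index_chart[OF pc N[of X'] Nc] by simp
      moreover have "compl N (l c)" "compl N (l e)" using Nc ce by auto
      ultimately show "P c e" unfolding P_def
        using hormander_index_indep[of X X' "l c" "l e" N] N by auto
    qed
  qed
  then show ?thesis using M unfolding P_def by blast
qed

end

theorem corollary3p4: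
  fixes \<omega> :: "'a::euclidean_space \<Rightarrow> 'a \<Rightarrow> real"
    and n :: nat and a b :: real and l :: "real \<Rightarrow> 'a set" and L0 L1 :: "'a set"
  assumes "symplectic_form \<omega>"
    and "DIM('a) = 2 * n"
    and "lagrangian_path \<omega> a b l"
    and "L0 \<in> lagrangians \<omega>"
    and "L1 \<in> lagrangians \<omega>"
  shows "\<bar>maslov_index \<omega> L0 a b l - maslov_index \<omega> L1 a b l\<bar>
           \<le> int n - int (dim (l a \<inter> l b))"
proof -
  interpret symplectic_space \<omega> by unfold_locales (rule assms(1))
  have "a \<le> b" using path_le[OF assms(3)] .
  then have lags: "{L0, L1, l a, l b} \<subseteq> lagrangians \<omega>"
    using assms(4,5) path_lagrangian[OF assms(3)] by auto
  obtain M where M: "\<And>L. L \<in> {L0, L1, l a, l b} \<Longrightarrow> compl M L"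
    by (rule common_complement[OF _ lags]) auto
  have eq: "maslov_index \<omega> L0 a b l - maslov_index \<omega> L1 a b l = hormander_index M L0 L1 (l a) (l b)"
    using maslov_index_eq_path_index[OF assms(4,3)] maslov_index_eq_path_index[OF assms(5,3)]
      path_index_diff[OF assms(4,5,3) M] by simp
  have "2 * (hormander_index M L0 L1 (l a) (l b) + int (dim (l a \<inter> l b))) \<le> 2 * int n"
    using hormander_index_le[of L0 L1 "l a" "l b" M] M assms(2) by simp
  moreover have "2 * (hormander_index M L1 L0 (l a) (l b) + int (dim (l a \<inter> l b))) \<le> 2 * int n"
    using hormander_index_le[of L1 L0 "l a" "l b" M] M assms(2) by (simp add: insert_commute)
  moreover have "hormander_index M L1 L0 (l a) (l b) = - hormander_index M L0 L1 (l a) (l b)"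
    by (simp add: hormander_index_def)
  moreover have "\<bar>f\<bar> \<le> m - d" if "2 * (f + d) \<le> 2 * m" "2 * (g + d) \<le> 2 * m" "g = - f" for f g d m :: int
    using that by (simp add: abs_le_iff)
  ultimately show ?thesis unfolding eq by blast
qed

end
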